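(* Let $a\le A<B\le b$, $\alpha,\beta\in(0,1)$, and let $L:[a,b]\times\mathbb{R}^3\to\mathbb{R}$, $(x,y,u,v)\mapsto L(x,y,u,v)$, have continuous first and second partial derivatives with respect to all its arguments. Put $$\mathcal{J}(y)=\int_A^B L\big(x,y(x),{_a\mathcal{D}_x^\alpha}y(x),{_x\mathcal{D}_b^\beta}y(x)\big)\,dx$$ for admissible functions $y:[a,b]\to\mathbb{R}$. Let the admissible function $y$ be a local extremizer of $\mathcal{J}$ subject to the boundary conditions $y(a)=y_a$, $y(b)=y_b$, and let $L$ satisfy along $y$ the regularity conditions listed in the context. Then $y$ satisfies $$\frac{\partial L}{\partial y}+{_x\mathcal{D}_B^\alpha}\frac{\partial L}{\partial u}+{_A\mathcal{D}_x^\beta}\frac{\partial L}{\partial v}=0\quad\text{for all }x\in[A,B],$$ $${_x\mathcal{D}_B^\alpha}\frac{\partial L}{\partial u}-{_x\mathcal{D}_A^\alpha}\frac{\partial L}{\partial u}=0\quad\text{for all }x\in[a,A],$$ $${_A\mathcal{D}_x^\beta}\frac{\partial L}{\partial v}-{_B\mathcal{D}_x^\beta}\frac{\partial L}{\partial v}=0\quad\text{for all }x\in[B,b],$$ where the partial derivatives of $L$ are evaluated at $\big(x,y(x),{_a\mathcal{D}_x^\alpha}y(x),{_x\mathcal{D}_b^\beta}y(x)\big)$.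
   Context: For $\gamma\in(0,1)$, real numbers $c<d$ and a continuous function $f$, the left and right Riemann-Liouville fractional derivatives are $${_c\mathcal{D}_x^\gamma}f(x)=\frac{1}{\Gamma(1-\gamma)}\frac{d}{dx}\int_c^x (x-t)^{-\gamma}f(t)\,dt\quad (x>c),\qquad {_x\mathcal{D}_d^\gamma}f(x)=\frac{-1}{\Gamma(1-\gamma)}\frac{d}{dx}\int_x^d (t-x)^{-\gamma}f(t)\,dt\quad (x<d).$$ Saying that such a derivative is continuous on a closed interval means that it exists and extends continuously to the endpoint where the formula is not defined. Equations at endpoints of the intervals $[A,B]$, $[a,A]$, $[B,b]$ are understood as limits from inside the interval; the equation on $[a,A]$ is void if $a=A$, and the one on $[B,b]$ is void if $B=b$. Admissible functions: continuous $y:[a,b]\to\mathbb{R}$ such that ${_a\mathcal{D}_x^\alpha}y$ and ${_x\mathcal{D}_b^\beta}y$ are continuous on $[a,b]$. Each of these two requirements is imposed only if the corresponding derivative is present (i.e. $L$ depends on $u$, respectively on $v$); if a derivative is not present, the corresponding argument is simply omitted. The prescribed boundary values satisfy $y_a=0$ if left fractional derivatives are present and $y_b=0$ if right fractional derivatives are present. Regularity conditions along $y$: $x\mapsto\frac{\partial L}{\partial u}(x,y(x),{_a\mathcal{D}_x^\alpha}y(x),{_x\mathcal{D}_b^\beta}y(x))$ has continuous right fractional derivative ${_x\mathcal{D}_b^\alpha}$ on $[a,b]$, and $x\mapsto\frac{\partial L}{\partial v}(x,y(x),{_a\mathcal{D}_x^\alpha}y(x),{_x\mathcal{D}_b^\beta}y(x))$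 has continuous left fractional derivative ${_a\mathcal{D}_x^\beta}$ on $[a,b]$. Local extremizer: fix a norm $\|\cdot\|$ on the linear space of admissible functions. $y$ is a local extremizer of $\mathcal{J}$ subject to the boundary conditions if $y$ is admissible and satisfies them, and there is $\delta>0$ such that either $\mathcal{J}(y)\le\mathcal{J}(y_1)$ for all, or $\mathcal{J}(y)\ge\mathcal{J}(y_1)$ for all, admissible $y_1$ satisfying the same boundary conditions with $\|y-y_1\|<\delta$. *)

theory Defs
  imports "HOL-Analysis.Analysis"
begin

text \<open>
  Functions on a closed interval are modelled as total functions; nothing below depends on
  their values outside that interval. The left derivative with base point \<open>c\<close> is taken for
  functions living on \<open>{c..d}\<close>, the right derivative with base point \<open>d\<close> likewise. The
  outer derivative is taken within \<open>{c..d}\<close>, so it is two-sided in the interior and one-sided at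
  the end that is not the base point. At the base point, where the formula is not
  defined, the value is the limit from inside the interval.
\<close>

definition rl_left_int :: "real \<Rightarrow> real \<Rightarrow> (real \<Rightarrow> real) \<Rightarrow> real \<Rightarrow> real" where
  "rl_left_int c \<gamma> f x = integral {c..x} (\<lambda>t. (x - t) powr (- \<gamma>) * f t)"

definition rl_right_int :: "real \<Rightarrow> real \<Rightarrow> (real \<Rightarrow> real) \<Rightarrow> real \<Rightarrow> real" where
  "rl_right_int d \<gamma> f x = integral {x..d} (\<lambda>t. (t - x) powr (- \<gamma>) * f t)"

definition rl_left_exists :: "real \<Rightarrow> real \<Rightarrow> real \<Rightarrow> (real \<Rightarrow> real) \<Rightarrow> real \<Rightarrow> bool" where
  "rl_left_exists c d \<gamma> f x \<longleftrightarrow> rl_left_int c \<gamma> f differentiable (at x within {c..d})"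

definition rl_right_exists :: "real \<Rightarrow> real \<Rightarrow> real \<Rightarrow> (real \<Rightarrow> real) \<Rightarrow> real \<Rightarrow> bool" where
  "rl_right_exists c d \<gamma> f x \<longleftrightarrow> rl_right_int d \<gamma> f differentiable (at x within {c..d})"

definition rl_left_formula :: "real \<Rightarrow> real \<Rightarrow> real \<Rightarrow> (real \<Rightarrow> real) \<Rightarrow> real \<Rightarrow> real" where
  "rl_left_formula c d \<gamma> f x =
     1 / Gamma (1 - \<gamma>) * vector_derivative (rl_left_int c \<gamma> f) (at x within {c..d})"

definition rl_right_formula :: "real \<Rightarrow> real \<Rightarrow> real \<Rightarrow> (real \<Rightarrow> real) \<Rightarrow> real \<Rightarrow> real" where
  "rl_right_formula c d \<gamma> f x =
     - 1 / Gamma (1 - \<gamma>) * vector_derivative (rl_right_int d \<gamma> f) (at x within {c..d})"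

definition rl_left :: "real \<Rightarrow> real \<Rightarrow> real \<Rightarrow> (real \<Rightarrow> real) \<Rightarrow> real \<Rightarrow> real" where
  "rl_left c d \<gamma> f x =
     (if x = c then Lim (at_right c) (rl_left_formula c d \<gamma> f) else rl_left_formula c d \<gamma> f x)"

definition rl_right :: "real \<Rightarrow> real \<Rightarrow> real \<Rightarrow> (real \<Rightarrow> real) \<Rightarrow> real \<Rightarrow> real" where
  "rl_right c d \<gamma> f x =
     (if x = d then Lim (at_left d) (rl_right_formula c d \<gamma> f) else rl_right_formula c d \<gamma> f x)"

text \<open>
  Continuity of \<open>rl_left\<close> at \<open>c\<close> forces the limit in its definition to exist, even
  though \<^const>\<open>Lim\<close> is total; similarly for \<open>rl_right\<close> at \<open>d\<close>.
\<close>

definition rl_left_continuous :: "real \<Rightarrow> real \<Rightarrow> real \<Rightarrow> (real \<Rightarrow> real) \<Rightarrow> bool" where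
  "rl_left_continuous c d \<gamma> f \<longleftrightarrow>
     (\<forall>x\<in>{c<..d}. rl_left_exists c d \<gamma> f x) \<and> continuous_on {c..d} (rl_left c d \<gamma> f)"

definition rl_right_continuous :: "real \<Rightarrow> real \<Rightarrow> real \<Rightarrow> (real \<Rightarrow> real) \<Rightarrow> bool" where
  "rl_right_continuous c d \<gamma> f \<longleftrightarrow>
     (\<forall>x\<in>{c..<d}. rl_right_exists c d \<gamma> f x) \<and> continuous_on {c..d} (rl_right c d \<gamma> f)"

type_synonym lagrangian = "real \<Rightarrow> real \<Rightarrow> real \<Rightarrow> real \<Rightarrow> real"

definition has_continuous_partials ::
  "real \<Rightarrow> real \<Rightarrow> lagrangian \<Rightarrow> lagrangian \<Rightarrow> lagrangian \<Rightarrow> lagrangian \<Rightarrow> lagrangian \<Rightarrow> bool" where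
  "has_continuous_partials a b F Fx Fy Fu Fv \<longleftrightarrow>
     (\<forall>x\<in>{a..b}. \<forall>y u v.
        ((\<lambda>s. F s y u v) has_real_derivative Fx x y u v) (at x within {a..b}) \<and>
        ((\<lambda>s. F x s u v) has_real_derivative Fy x y u v) (at y) \<and>
        ((\<lambda>s. F x y s v) has_real_derivative Fu x y u v) (at u) \<and>
        ((\<lambda>s. F x y u s) has_real_derivative Fv x y u v) (at v)) \<and>
     (\<forall>G\<in>{Fx, Fy, Fu, Fv}. continuous_on ({a..b} \<times> UNIV) (\<lambda>(x, y, u, v). G x y u v))"

definition C2_lagrangian :: "real \<Rightarrow> real \<Rightarrow> lagrangian \<Rightarrow> bool" where
  "C2_lagrangian a b L \<longleftrightarrow>
     (\<exists>Lx Ly Lu Lv. has_continuous_partials a b L Lx Ly Lu Lv \<and>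
        (\<forall>G\<in>{Lx, Ly, Lu, Lv}. \<exists>Gx Gy Gu Gv. has_continuous_partials a b G Gx Gy Gu Gv))"

definition partial_y :: "lagrangian \<Rightarrow> lagrangian" where
  "partial_y L x y u v = deriv (\<lambda>s. L x s u v) y"

definition partial_u :: "lagrangian \<Rightarrow> lagrangian" where
  "partial_u L x y u v = deriv (\<lambda>s. L x y s v) u"

definition partial_v :: "lagrangian \<Rightarrow> lagrangian" where
  "partial_v L x y u v = deriv (\<lambda>s. L x y u s) v"

definition depends_on_u :: "real \<Rightarrow> real \<Rightarrow> lagrangian \<Rightarrow> bool" where
  "depends_on_u a b L \<longleftrightarrow> (\<exists>x\<in>{a..b}. \<exists>y u u' v. L x y u v \<noteq> L x y u' v)"

definition depends_on_v :: "real \<Rightarrow> real \<Rightarrow> lagrangian \<Rightarrow> bool" where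
  "depends_on_v a b L \<longleftrightarrow> (\<exists>x\<in>{a..b}. \<exists>y u v v'. L x y u v \<noteq> L x y u v')"

text \<open>
  If \<open>L\<close> does not depend on \<open>u\<close> (or \<open>v\<close>), the derivative in that slot need not exist; the
  arbitrary value then standing there does not influence \<open>L\<close> or its partial derivatives.
\<close>

definition along ::
  "real \<Rightarrow> real \<Rightarrow> real \<Rightarrow> real \<Rightarrow> lagrangian \<Rightarrow> (real \<Rightarrow> real) \<Rightarrow> real \<Rightarrow> real" where
  "along a b \<alpha> \<beta> F y x = F x (y x) (rl_left a b \<alpha> y x) (rl_right a b \<beta> y x)"

definition admissible ::
  "real \<Rightarrow> real \<Rightarrow> real \<Rightarrow> real \<Rightarrow> lagrangian \<Rightarrow> (real \<Rightarrow> real) \<Rightarrow> bool" where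
  "admissible a b \<alpha> \<beta> L y \<longleftrightarrow>
     continuous_on {a..b} y \<and>
     (depends_on_u a b L \<longrightarrow> rl_left_continuous a b \<alpha> y) \<and>
     (depends_on_v a b L \<longrightarrow> rl_right_continuous a b \<beta> y)"

definition action ::
  "real \<Rightarrow> real \<Rightarrow> real \<Rightarrow> real \<Rightarrow> real \<Rightarrow> real \<Rightarrow> lagrangian \<Rightarrow> (real \<Rightarrow> real) \<Rightarrow> real" where
  "action a b A B \<alpha> \<beta> L y = integral {A..B} (along a b \<alpha> \<beta> L y)"

text \<open>
  A norm on a linear space \<open>V\<close> of functions on \<open>{a..b}\<close>. Two total functions agreeing on
  \<open>{a..b}\<close> represent the same element of the space, whence the form of definiteness.
\<close>

definition norm_on :: "real \<Rightarrow> real \<Rightarrow> ((real \<Rightarrow> real) \<Rightarrow> bool) \<Rightarrow> ((real \<Rightarrow> real) \<Rightarrow> real) \<Rightarrow> bool" where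
  "norm_on a b V N \<longleftrightarrow>
     (\<forall>f. V f \<longrightarrow> N f \<ge> 0 \<and> (N f = 0 \<longleftrightarrow> (\<forall>x\<in>{a..b}. f x = 0))) \<and>
     (\<forall>f k. V f \<longrightarrow> N (\<lambda>x. k * f x) = \<bar>k\<bar> * N f) \<and>
     (\<forall>f g. V f \<longrightarrow> V g \<longrightarrow> N (\<lambda>x. f x + g x) \<le> N f + N g)"

definition local_extremizer ::
  "real \<Rightarrow> real \<Rightarrow> ((real \<Rightarrow> real) \<Rightarrow> bool) \<Rightarrow> ((real \<Rightarrow> real) \<Rightarrow> real) \<Rightarrow> ((real \<Rightarrow> real) \<Rightarrow> real) \<Rightarrow>
   real \<Rightarrow> real \<Rightarrow> (real \<Rightarrow> real) \<Rightarrow> bool" where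
  "local_extremizer a b V N J ya yb y \<longleftrightarrow>
     V y \<and> y a = ya \<and> y b = yb \<and>
     (\<exists>\<delta>>0.
        (\<forall>y1. V y1 \<and> y1 a = ya \<and> y1 b = yb \<and> N (\<lambda>x. y x - y1 x) < \<delta> \<longrightarrow> J y \<le> J y1) \<or>
        (\<forall>y1. V y1 \<and> y1 a = ya \<and> y1 b = yb \<and> N (\<lambda>x. y x - y1 x) < \<delta> \<longrightarrow> J y \<ge> J y1))"

text \<open>The equation \<open>E = 0\<close> on \<open>{lo..hi}\<close>, read at the endpoints as a limit from inside.\<close>

definition vanishes_on_interval :: "real \<Rightarrow> real \<Rightarrow> (real \<Rightarrow> real) \<Rightarrow> bool" where
  "vanishes_on_interval lo hi E \<longleftrightarrow>
     (\<forall>x\<in>{lo<..<hi}. E x = 0) \<and> (E \<longlongrightarrow> 0) (at_right lo) \<and> (E \<longlongrightarrow> 0) (at_left hi)"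

end

theory Submission
  imports Defs
begin

text \<open>
  Perturb \<open>y\<close> by multiples of the \<open>C\<^sup>1\<close> function \<open>((x - c) (d - x))\<^sup>2\<close> supported in \<open>{c..d}\<close>. Its
  fractional derivatives are weakly singular integrals of its ordinary derivative, so every
  perturbation is admissible and the first variation vanishes. Fubini's theorem and integration by
  parts on \<open>{c..d}\<close> move the fractional derivatives onto \<open>\<partial>L/\<partial>u\<close> and \<open>\<partial>L/\<partial>v\<close>. Because the
  action only integrates over \<open>{A..B}\<close>, an interval \<open>{c..d}\<close> inside \<open>{A..B}\<close> produces the derivatives
  truncated at \<open>A\<close> and \<open>B\<close>, whereas one to the left of \<open>A\<close> (to the right of \<open>B\<close>) sees only the left
  (right) fractional derivative of the perturbation and produces the difference of two truncations.
  The truncated derivatives exist since moving the base point changes the fractional integral by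
  the integral of a kernel that is smooth away from the new base point. Shrinking \<open>{c..d}\<close> gives the
  equations on the open intervals, and the endpoint limits are then trivial. Right-sided statements
  follow from left-sided ones by the reflection \<open>x \<mapsto> - x\<close>.
\<close>

subsection \<open>Weakly singular kernels\<close>

text \<open>The substitution \<open>r = (x - t) powr (1 - \<gamma>)\<close> makes the singular integrand continuous.\<close>
lemma has_integral_rl_kernel_left:
  fixes g :: "real \<Rightarrow> real"
  assumes \<gamma>: "\<gamma> < 1" and "c \<le> x" and g: "continuous_on {c..x} g"
  shows "((\<lambda>t. (x - t) powr (- \<gamma>) * g t) has_integral
           (1 / (1 - \<gamma>) * integral {0..(x - c) powr (1 - \<gamma>)}
              (\<lambda>r. g (x - r powr (1 / (1 - \<gamma>)))))) {c..x}"
proof -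
  define \<phi> where "\<phi> t = (x - t) powr (1 - \<gamma>)" for t
  define \<phi>' where "\<phi>' t = - (1 - \<gamma>) * (x - t) powr (- \<gamma>)" for t
  define F where "F r = g (x - r powr (1 / (1 - \<gamma>)))" for r
  define R where "R = (x - c) powr (1 - \<gamma>)"
  have R: "R powr (1 / (1 - \<gamma>)) = x - c" "0 \<le> R"
    using assms by (auto simp: R_def powr_powr)
  have inv: "\<phi> t powr (1 / (1 - \<gamma>)) = x - t" if "t \<le> x" for t
    using that \<gamma> by (simp add: \<phi>_def powr_powr)
  have "((\<lambda>t. \<phi>' t *\<^sub>R F (\<phi> t)) has_integral
      (integral {\<phi> c..\<phi> x} F - integral {\<phi> x..\<phi> c} F)) {c..x}"
  \<comment> \<open>The end point \<open>x\<close> is the one exceptional point of the substitution: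
    there \<open>\<phi>\<close> is continuous but need not be differentiable.\<close>
  proof (rule has_integral_substitution_general[where s = "{x}" and c = 0 and d = R])
    show "\<phi> ` {c..x} \<subseteq> {0..R}"
      using \<gamma> by (auto simp: \<phi>_def R_def intro!: powr_mono2)
    show "continuous_on {0..R} F" unfolding F_def
    proof (rule continuous_on_compose2[OF g])
      show "continuous_on {0..R} (\<lambda>r. x - r powr (1 / (1 - \<gamma>)))"
        using \<gamma> by (intro continuous_intros continuous_on_powr') auto
      show "(\<lambda>r. x - r powr (1 / (1 - \<gamma>))) ` {0..R} \<subseteq> {c..x}"
      proof clarsimp
        fix r assume "0 \<le> r" "r \<le> R"
        then have "r powr (1 / (1 - \<gamma>)) \<le> R powr (1 / (1 - \<gamma>))"
          using \<gamma> by (intro powr_mono2) auto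
        then show "c \<le> x - r powr (1 / (1 - \<gamma>))" using R by simp
      qed
    qed
    show "continuous_on {c..x} \<phi>"
      unfolding \<phi>_def using \<gamma> by (intro continuous_intros continuous_on_powr') auto
    show "(\<phi> has_field_derivative \<phi>' t) (at t within {c..x})" if "t \<in> {c..x} - {x}" for t
    proof -
      have "(\<phi> has_field_derivative (1 - \<gamma>) * (x - t) powr (1 - \<gamma> - 1) * (- 1)) (at t)"
        unfolding \<phi>_def using that
        by (intro DERIV_chain2[OF has_real_derivative_powr] derivative_eq_intros) auto
      moreover have "(1 - \<gamma>) * (x - t) powr (1 - \<gamma> - 1) * (- 1) = \<phi>' t"
        by (simp add: \<phi>'_def algebra_simps)
      ultimately show ?thesis by (simp add: has_field_derivative_at_within)
    qed
  qed (use assms in auto)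
  moreover have "\<phi> x = 0" "\<phi> c = R"
    by (auto simp: \<phi>_def R_def)
  \<comment> \<open>As \<open>\<phi>\<close> decreases from \<open>R\<close> to \<open>0\<close>,
    the substitution reverses orientation. Only the integral over \<open>{0..R}\<close> survives,
    with a minus sign that the factor \<open>- 1 / (1 - \<gamma>)\<close> below cancels.\<close>
  moreover have "integral {R..0} F = 0"
    using R(2) by (cases "R = 0") auto
  ultimately have "((\<lambda>t. \<phi>' t *\<^sub>R F (\<phi> t)) has_integral - integral {0..R} F) {c..x}"
    by simp
  then have "((\<lambda>t. - 1 / (1 - \<gamma>) * (\<phi>' t *\<^sub>R F (\<phi> t))) has_integral
      (- 1 / (1 - \<gamma>) * - integral {0..R} F)) {c..x}"
    by (rule has_integral_mult_right)
  then have "((\<lambda>t. - 1 / (1 - \<gamma>) * (\<phi>' t *\<^sub>R F (\<phi> t))) has_integral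
      (1 / (1 - \<gamma>) * integral {0..R} F)) {c..x}"
    by simp
  moreover have "- 1 / (1 - \<gamma>) * (\<phi>' t *\<^sub>R F (\<phi> t)) = (x - t) powr (- \<gamma>) * g t"
    if "t \<in> {c..x}" for t
    using that \<gamma> by (simp add: \<phi>'_def F_def inv field_simps)
  ultimately have "((\<lambda>t. (x - t) powr (- \<gamma>) * g t) has_integral
      (1 / (1 - \<gamma>) * integral {0..R} F)) {c..x}"
    by (rule has_integral_eq[rotated])
  then show ?thesis unfolding R_def F_def[abs_def] .
qed

text \<open>Substitution of \<open>- t\<close> for \<open>t\<close>. This identity is the bridge by
  which left-sided results are carried over to the right side.\<close>

lemma rl_left_int_uminus:
  "rl_left_int c \<gamma> f x = rl_right_int (- c) \<gamma> (\<lambda>t. f (- t)) (- x)"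
  using Henstock_Kurzweil_Integration.integral_reflect_real[of x c "\<lambda>t. (x - t) powr (- \<gamma>) * f t"]
  by (simp add: rl_left_int_def rl_right_int_def add.commute)

lemma integrable_rl_kernel_left:
  fixes g :: "real \<Rightarrow> real"
  assumes "\<gamma> < 1" and "continuous_on {c..x} g"
  shows "(\<lambda>t. (x - t) powr (- \<gamma>) * g t) integrable_on {c..x}"
  using has_integral_rl_kernel_left[of \<gamma> c x g] assms
  by (cases "c \<le> x") (auto simp: integrable_on_def)

lemma integrable_rl_kernel_right:
  fixes g :: "real \<Rightarrow> real"
  assumes "\<gamma> < 1" and "continuous_on {x..d} g"
  shows "(\<lambda>t. (t - x) powr (- \<gamma>) * g t) integrable_on {x..d}"
proof -
  have "continuous_on {-d..-x} (\<lambda>t. g (- t))"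
    by (rule continuous_on_compose2[OF assms(2)]) (auto intro!: continuous_intros)
  from integrable_rl_kernel_left[OF assms(1) this]
  have "(\<lambda>t. (\<lambda>t. (t - x) powr (- \<gamma>) * g t) (- t)) integrable_on {-d..-x}"
    by (simp add: minus_diff_commute)
  then show ?thesis by (subst (asm) Henstock_Kurzweil_Integration.integrable_reflect_real)
qed

section \<open>Fubini's theorem for weakly singular kernels\<close>

text \<open>Gauge integrability of a function and of its absolute value gives Lebesgue integrability
  for the completed measure; Borel measurability brings this down to \<open>lborel\<close>, for
  whose product Fubini's theorem is used.\<close>

lemma set_integrable_lborelI:
  fixes f :: "real \<Rightarrow> real"
  assumes "f integrable_on S" "(\<lambda>x. \<bar>f x\<bar>) integrable_on S"
    and "set_borel_measurable lborel S f"
  shows "set_integrable lborel S f"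
proof -
  have "f absolutely_integrable_on S"
    using assms by (intro absolutely_integrable_onI) auto
  then show ?thesis
    using assms(3) unfolding set_integrable_def set_borel_measurable_def
    by (simp add: integrable_completion)
qed

lemma set_integrable_rl_kernel_left:
  fixes g :: "real \<Rightarrow> real"
  assumes "\<gamma> < 1" and g: "continuous_on {c..x} g"
  shows "set_integrable lborel {c..x} (\<lambda>t. (x - t) powr (- \<gamma>) * g t)"
proof (rule set_integrable_lborelI)
  show "(\<lambda>t. (x - t) powr (- \<gamma>) * g t) integrable_on {c..x}"
    by (rule integrable_rl_kernel_left[OF assms])
  show "(\<lambda>t. \<bar>(x - t) powr (- \<gamma>) * g t\<bar>) integrable_on {c..x}"
    using integrable_rl_kernel_left[OF assms(1), of c x "\<lambda>t. \<bar>g t\<bar>"] g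
    by (simp add: abs_mult continuous_on_rabs)
  have "(\<lambda>t. indicator {c..x} t *\<^sub>R g t) \<in> borel_measurable borel"
    by (intro borel_measurable_continuous_on_indicator g) auto
  then have "(\<lambda>t. (x - t) powr (- \<gamma>) * (indicator {c..x} t *\<^sub>R g t)) \<in> borel_measurable borel"
    by measurable
  then show "set_borel_measurable lborel {c..x} (\<lambda>t. (x - t) powr (- \<gamma>) * g t)"
    by (simp add: set_borel_measurable_def mult_ac)
qed

lemma set_integrable_rl_kernel_right:
  fixes g :: "real \<Rightarrow> real"
  assumes "\<gamma> < 1" and g: "continuous_on {x..d} g"
  shows "set_integrable lborel {x..d} (\<lambda>t. (t - x) powr (- \<gamma>) * g t)"
proof (rule set_integrable_lborelI)
  show "(\<lambda>t. (t - x) powr (- \<gamma>) * g t) integrable_on {x..d}"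
    by (rule integrable_rl_kernel_right[OF assms])
  show "(\<lambda>t. \<bar>(t - x) powr (- \<gamma>) * g t\<bar>) integrable_on {x..d}"
    using integrable_rl_kernel_right[OF assms(1), of x d "\<lambda>t. \<bar>g t\<bar>"] g
    by (simp add: abs_mult continuous_on_rabs)
  have "(\<lambda>t. indicator {x..d} t *\<^sub>R g t) \<in> borel_measurable borel"
    by (intro borel_measurable_continuous_on_indicator g) auto
  then have "(\<lambda>t. (t - x) powr (- \<gamma>) * (indicator {x..d} t *\<^sub>R g t)) \<in> borel_measurable borel"
    by measurable
  then show "set_borel_measurable lborel {x..d} (\<lambda>t. (t - x) powr (- \<gamma>) * g t)"
    by (simp add: set_borel_measurable_def mult_ac)
qed

text \<open>Both sides are iterated integrals of
  \<open>p x * (x - t) powr (- \<gamma>) * g t\<close> over the region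
  \<open>A \<le> x \<le> B\<close>, \<open>a \<le> t \<le> x\<close>; for fixed \<open>t\<close> the
  variable \<open>x\<close> starts at \<open>max A t\<close>. For \<open>t\<close> beyond
  \<open>B\<close> the inner interval is empty.\<close>

lemma rl_kernel_integral_swap:
  fixes p g :: "real \<Rightarrow> real"
  assumes \<gamma>: "\<gamma> < 1" and AB: "a \<le> A" "A \<le> B" "B \<le> b"
    and p: "continuous_on {A..B} p" and g: "continuous_on {a..b} g"
  shows "integral {A..B} (\<lambda>x. p x * integral {a..x} (\<lambda>t. (x - t) powr (- \<gamma>) * g t)) =
         integral {a..b} (\<lambda>t. g t * integral {max A t..B} (\<lambda>x. (x - t) powr (- \<gamma>) * p x))"
proof -
  define P where "P x = indicator {A..B} x *\<^sub>R p x" for x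
  define G where "G t = indicator {a..b} t *\<^sub>R g t" for t
  \<comment> \<open>Since \<open>0 powr r = 0\<close>, clipping at zero makes the kernel vanish for
    \<open>x \<le> t\<close>, so the triangular region is built into a single Borel function on the
    plane.\<close>
  define k where "k x t = max 0 (x - t) powr (- \<gamma>)" for x t
  define f where "f x t = P x * (k x t * G t)" for x t
  have [measurable]: "P \<in> borel_measurable borel" "G \<in> borel_measurable borel"
    unfolding P_def G_def by (intro borel_measurable_continuous_on_indicator p g; simp)+
  have k_meas [measurable]: "(\<lambda>(x, t). k x t) \<in> borel_measurable (borel \<Otimes>\<^sub>M borel)"
    unfolding k_def by measurable
  have f_meas [measurable]: "(\<lambda>(x, t). f x t) \<in> borel_measurable (lborel \<Otimes>\<^sub>M lborel)"
    unfolding f_def by measurable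
  have kG: "k x t * G t = indicator {a..x} t *\<^sub>R ((x - t) powr (- \<gamma>) * g t)"
    if "x \<le> b" for x t
    using that by (cases "t < x") (auto simp: k_def G_def indicator_def)
  have kG_int: "integrable lborel (\<lambda>t. k x t * G t)" if "x \<le> b" for x
    using set_integrable_rl_kernel_left[OF \<gamma>, of a x g] that continuous_on_subset[OF g]
    by (simp add: kG set_integrable_def)
  have kG_val: "(LINT t|lborel. k x t * G t) = integral {a..x} (\<lambda>t. (x - t) powr (- \<gamma>) * g t)"
    if "x \<le> b" for x
    using set_borel_integral_eq_integral(2)[OF set_integrable_rl_kernel_left[OF \<gamma>, of a x g]] that
      continuous_on_subset[OF g]
    by (simp add: kG set_lebesgue_integral_def)
  have Pk: "P x * k x t = indicator {max A t..B} x *\<^sub>R ((x - t) powr (- \<gamma>) * p x)" for x t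
    by (cases "t < x") (auto simp: k_def P_def indicator_def)
  have Pk_int: "set_integrable lborel {max A t..B} (\<lambda>x. (x - t) powr (- \<gamma>) * p x)" for t
  proof (cases "t \<ge> A")
    case True
    then show ?thesis
      using set_integrable_rl_kernel_right[OF \<gamma>, of t B p] continuous_on_subset[OF p]
      by (simp add: max_def)
  next
    case False
    \<comment> \<open>For \<open>t < A\<close> the singularity lies outside the domain of
      integration.\<close>
    have "continuous_on {A..B} (\<lambda>x. (x - t) powr (- \<gamma>) * p x)"
      using False by (intro continuous_intros p) auto
    then show ?thesis
      using False borel_integrable_atLeastAtMost'[of A B] by (simp add: max_def)
  qed
  have Pk_val: "(LINT x|lborel. P x * k x t) =
      integral {max A t..B} (\<lambda>x. (x - t) powr (- \<gamma>) * p x)" for t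
    using set_borel_integral_eq_integral(2)[OF Pk_int[of t]]
    by (simp add: Pk set_lebesgue_integral_def)
  obtain Mp where Mp: "\<And>x. \<bar>P x\<bar> \<le> Mp"
  proof -
    have "bounded (p ` {A..B})" using p compact_continuous_image compact_imp_bounded compact_Icc by blast
    then obtain M where "\<And>x. x \<in> {A..B} \<Longrightarrow> \<bar>p x\<bar> \<le> M" unfolding bounded_iff by fastforce
    then have "\<And>x. \<bar>P x\<bar> \<le> \<bar>M\<bar>" unfolding P_def by (force simp: indicator_def)
    then show ?thesis using that by blast
  qed
  obtain Mg where Mg: "\<And>x. \<bar>G x\<bar> \<le> Mg"
  proof -
    have "bounded (g ` {a..b})" using g compact_continuous_image compact_imp_bounded compact_Icc by blast
    then obtain M where "\<And>x. x \<in> {a..b} \<Longrightarrow> \<bar>g x\<bar> \<le> M" unfolding bounded_iff by fastforce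
    then have "\<And>x. \<bar>G x\<bar> \<le> \<bar>M\<bar>" unfolding G_def by (force simp: indicator_def)
    then show ?thesis using that by blast
  qed
  have Mp0: "0 \<le> Mp" and Mg0: "0 \<le> Mg" using Mp[of 0] Mg[of 0] by linarith+
  \<comment> \<open>A bound for the inner integral, uniform in \<open>x\<close>, obtained from the
    explicit value \<open>(x - a) powr (1 - \<gamma>) / (1 - \<gamma>)\<close> of the integral of
    the kernel over \<open>{a..x}\<close>.\<close>
  define C where "C = Mg * ((b - a) powr (1 - \<gamma>) / (1 - \<gamma>))"
  have bound: "(LINT t|lborel. norm (f x t)) \<le> Mp * C" if x: "x \<in> {A..B}" for x
  proof -
    have xab: "a \<le> x" "x \<le> b" using x AB by auto
    have si: "set_integrable lborel {a..x} (\<lambda>t. (x - t) powr (- \<gamma>) * Mg)"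
      by (rule set_integrable_rl_kernel_left[OF \<gamma>]) auto
    have "(LINT t|lborel. norm (f x t)) = \<bar>P x\<bar> * (LINT t|lborel. norm (k x t * G t))"
      by (simp add: f_def abs_mult)
    also have "\<dots> \<le> Mp * (LINT t|lborel. indicator {a..x} t *\<^sub>R ((x - t) powr (- \<gamma>) * Mg))"
    proof (intro mult_mono Mp integral_mono)
      show "integrable lborel (\<lambda>t. norm (k x t * G t))"
        using kG_int[of x] xab by (rule_tac integrable_norm) auto
      show "integrable lborel (\<lambda>t. indicator {a..x} t *\<^sub>R ((x - t) powr (- \<gamma>) * Mg))"
        using si by (simp add: set_integrable_def)
      show "norm (k x t * G t) \<le> indicator {a..x} t *\<^sub>R ((x - t) powr (- \<gamma>) * Mg)" for t
      proof (cases "t \<in> {a..x}")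
        case True
        then have "norm (k x t * G t) = (x - t) powr (- \<gamma>) * \<bar>G t\<bar>"
          by (simp add: k_def abs_mult)
        then show ?thesis using True Mg[of t] by (simp add: mult_left_mono)
      qed (use kG[of x t] xab in auto)
      show "0 \<le> (LINT t|lborel. norm (k x t * G t))" by simp
    qed (use Mp0 in auto)
    also have "(LINT t|lborel. indicator {a..x} t *\<^sub>R ((x - t) powr (- \<gamma>) * Mg)) =
        integral {a..x} (\<lambda>t. (x - t) powr (- \<gamma>) * Mg)"
      using set_borel_integral_eq_integral(2)[OF si] unfolding set_lebesgue_integral_def .
    also have "\<dots> = Mg * ((x - a) powr (1 - \<gamma>) / (1 - \<gamma>))"
      using has_integral_rl_kernel_left[OF \<gamma> xab(1), of "\<lambda>_. Mg"] by (simp add: has_integral_iff)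
    also have "\<dots> \<le> C"
      unfolding C_def using xab \<gamma> Mg0
      by (intro mult_left_mono divide_right_mono powr_mono2) auto
    finally show ?thesis using Mp0 by (simp add: mult_left_mono)
  qed
  have "integrable (lborel \<Otimes>\<^sub>M lborel) (\<lambda>(x, t). f x t)"
  \<comment> \<open>Joint integrability by Tonelli: the inner integrals of the norm are bounded by a
    constant and vanish for \<open>x\<close> outside the bounded interval
    \<open>{A..B}\<close>.\<close>
  proof (rule lborel_pair.Fubini_integrable)
    show "integrable lborel (\<lambda>x. LINT t|lborel. norm (case (x, t) of (x, t) \<Rightarrow> f x t))"
    proof (rule integrableI_bounded_set[where A = "{A..B}" and B = "Mp * C"])
      show "(\<lambda>x. LINT t|lborel. norm (case (x, t) of (x, t) \<Rightarrow> f x t)) \<in> borel_measurable lborel"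
        by measurable
      show "AE x in lborel. x \<in> {A..B} \<longrightarrow>
          norm (LINT t|lborel. norm (case (x, t) of (x, t) \<Rightarrow> f x t)) \<le> Mp * C"
        using bound by simp
      show "AE x in lborel. x \<notin> {A..B} \<longrightarrow>
          (LINT t|lborel. norm (case (x, t) of (x, t) \<Rightarrow> f x t)) = 0"
        by (simp add: f_def P_def)
    qed (auto simp: emeasure_lborel_Icc_eq)
    show "AE x in lborel. integrable lborel (\<lambda>t. case (x, t) of (x, t) \<Rightarrow> f x t)"
    proof (rule AE_I2)
      fix x :: real
      show "integrable lborel (\<lambda>t. case (x, t) of (x, t) \<Rightarrow> f x t)"
      proof (cases "x \<in> {A..B}")
        case True
        then show ?thesis using kG_int[of x] AB by (simp add: f_def)
      qed (simp add: f_def P_def)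
    qed
  qed measurable
  note int = this
  have inner1: "(LINT t|lborel. f x t) =
      indicator {A..B} x *\<^sub>R (p x * integral {a..x} (\<lambda>t. (x - t) powr (- \<gamma>) * g t))" for x
    using AB by (cases "x \<in> {A..B}") (auto simp: f_def P_def kG_val)
  have inner2: "(LINT x|lborel. f x t) =
      indicator {a..b} t *\<^sub>R (g t * integral {max A t..B} (\<lambda>x. (x - t) powr (- \<gamma>) * p x))" for t
  proof -
    have "(LINT x|lborel. f x t) = (LINT x|lborel. G t * (P x * k x t))"
      by (rule arg_cong[where f="integral\<^sup>L lborel"]) (auto simp: f_def)
    also have "\<dots> = G t * (LINT x|lborel. P x * k x t)"
      by simp
    finally show ?thesis by (simp add: Pk_val G_def)
  qed
  have 1: "set_integrable lborel {A..B}
      (\<lambda>x. p x * integral {a..x} (\<lambda>t. (x - t) powr (- \<gamma>) * g t))"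
    using lborel_pair.integrable_fst'[OF int] by (simp add: set_integrable_def inner1)
  have 2: "set_integrable lborel {a..b}
      (\<lambda>t. g t * integral {max A t..B} (\<lambda>x. (x - t) powr (- \<gamma>) * p x))"
    using lborel_pair.integrable_snd[OF int] by (simp add: set_integrable_def inner2)
  have "(LINT t|lborel. LINT x|lborel. f x t) = (LINT x|lborel. LINT t|lborel. f x t)"
    by (rule lborel_pair.Fubini_integral[OF int])
  then show ?thesis
    using set_borel_integral_eq_integral(2)[OF 1] set_borel_integral_eq_integral(2)[OF 2]
    by (simp add: set_lebesgue_integral_def inner1 inner2)
qed

subsection \<open>Reflection and linearity of fractional derivatives\<close>

lemma Gamma_one_minus_nonzero: "Gamma (1 - \<gamma>) \<noteq> 0" if "\<gamma> < 1" for \<gamma> :: real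
  using Gamma_real_pos[of "1 - \<gamma>"] that by force

lemma rl_left_existsD:
  assumes "rl_left_exists c d \<gamma> f x" "c < d" "x \<in> {c..d}" "\<gamma> < 1"
  shows "(rl_left_int c \<gamma> f has_vector_derivative Gamma (1 - \<gamma>) * rl_left_formula c d \<gamma> f x)
           (at x within {c..d})"
proof -
  have "Gamma (1 - \<gamma>) \<noteq> 0" using assms by (simp add: Gamma_one_minus_nonzero)
  then show ?thesis
    using assms by (simp add: rl_left_exists_def rl_left_formula_def vector_derivative_works)
qed

text \<open>A derivative within a nondegenerate interval is unique, even at the end points, so any
  derivative found is the one selected by \<open>vector_derivative\<close>.\<close>

lemma rl_left_existsI:
  assumes "(rl_left_int c \<gamma> f has_vector_derivative D) (at x within {c..d})" "c < d" "x \<in> {c..d}"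
  shows "rl_left_exists c d \<gamma> f x" "rl_left_formula c d \<gamma> f x = D / Gamma (1 - \<gamma>)"
  using assms vector_derivative_within_cbox[OF assms(2), of x, simplified]
  by (auto simp: rl_left_exists_def rl_left_formula_def differentiableI_vector)

lemma rl_right_existsI:
  assumes "(rl_right_int d \<gamma> f has_vector_derivative D) (at x within {c..d})" "c < d" "x \<in> {c..d}"
  shows "rl_right_exists c d \<gamma> f x" "rl_right_formula c d \<gamma> f x = - D / Gamma (1 - \<gamma>)"
  using assms vector_derivative_within_cbox[OF assms(2), of x, simplified]
  by (auto simp: rl_right_exists_def rl_right_formula_def differentiableI_vector)

lemma rl_right_existsD:
  assumes "rl_right_exists c d \<gamma> f x" "c < d" "x \<in> {c..d}" "\<gamma> < 1"
  shows "(rl_right_int d \<gamma> f has_vector_derivative - Gamma (1 - \<gamma>) * rl_right_formula c d \<gamma> f x)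
           (at x within {c..d})"
proof -
  have "Gamma (1 - \<gamma>) \<noteq> 0" using assms by (simp add: Gamma_one_minus_nonzero)
  then show ?thesis
    using assms by (simp add: rl_right_exists_def rl_right_formula_def vector_derivative_works)
qed

lemma has_vector_derivative_uminus_within:
  fixes F :: "real \<Rightarrow> real"
  assumes "(F has_vector_derivative D) (at (- x) within uminus ` S)"
  shows "((\<lambda>x. F (- x)) has_vector_derivative - D) (at x within S)"
proof -
  have "(uminus has_vector_derivative (- 1 :: real)) (at x within S)"
    by (auto intro!: derivative_eq_intros)
  from vector_diff_chain_within[OF this assms] show ?thesis by (simp add: o_def)
qed

text \<open>The sign produced by the reflection is absorbed by the factor \<open>-1\<close> in the
  right derivative. Values are compared only where the derivative exists, since otherwise
  \<open>vector_derivative\<close> returns an unspecified number.\<close>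

lemma rl_right_formula_uminus:
  assumes "\<gamma> < 1" "c < d" "x \<in> {c..d}"
  shows "rl_right_exists c d \<gamma> f x \<longleftrightarrow> rl_left_exists (- d) (- c) \<gamma> (\<lambda>t. f (- t)) (- x)" (is "?R \<longleftrightarrow> ?L")
    and "rl_right_exists c d \<gamma> f x \<Longrightarrow>
           rl_right_formula c d \<gamma> f x = rl_left_formula (- d) (- c) \<gamma> (\<lambda>t. f (- t)) (- x)"
proof -
  have \<Gamma>: "Gamma (1 - \<gamma>) \<noteq> 0" using assms(1) by (simp add: Gamma_one_minus_nonzero)
  have im: "uminus ` {c..d} = {-d..-c}" "uminus ` {-d..-c} = {c..d}" by auto
  have RL: ?L "rl_left_formula (- d) (- c) \<gamma> (\<lambda>t. f (- t)) (- x) = rl_right_formula c d \<gamma> f x" if ?R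
  proof -
    have "(rl_right_int d \<gamma> f has_vector_derivative - Gamma (1 - \<gamma>) * rl_right_formula c d \<gamma> f x)
           (at (- (- x)) within uminus ` {-d..-c})"
      using rl_right_existsD[OF that assms(2,3,1)] im by simp
    from has_vector_derivative_uminus_within[OF this]
    have "(rl_left_int (- d) \<gamma> (\<lambda>t. f (- t)) has_vector_derivative
        Gamma (1 - \<gamma>) * rl_right_formula c d \<gamma> f x) (at (- x) within {-d..-c})"
      by (simp add: rl_left_int_uminus[abs_def])
    from rl_left_existsI[OF this] assms \<Gamma>
    show ?L "rl_left_formula (- d) (- c) \<gamma> (\<lambda>t. f (- t)) (- x) = rl_right_formula c d \<gamma> f x"
      by auto
  qed
  have "?R" if ?L
  proof -
    have "(rl_left_int (- d) \<gamma> (\<lambda>t. f (- t)) has_vector_derivative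
        Gamma (1 - \<gamma>) * rl_left_formula (- d) (- c) \<gamma> (\<lambda>t. f (- t)) (- x))
           (at (- x) within uminus ` {c..d})"
      using rl_left_existsD[OF that _ _ assms(1)] assms im by simp
    from has_vector_derivative_uminus_within[OF this]
    have "(rl_right_int d \<gamma> f has_vector_derivative
        - (Gamma (1 - \<gamma>) * rl_left_formula (- d) (- c) \<gamma> (\<lambda>t. f (- t)) (- x))) (at x within {c..d})"
      by (simp add: rl_left_int_uminus)
    from rl_right_existsI(1)[OF this] assms show ?R by auto
  qed
  with RL show "?R \<longleftrightarrow> ?L" by blast
  show "rl_right_formula c d \<gamma> f x = rl_left_formula (- d) (- c) \<gamma> (\<lambda>t. f (- t)) (- x)" if ?R
    using RL that by simp
qed

lemma rl_right_uminus_interior: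
  assumes "\<gamma> < 1" "c < d" "x \<in> {c..<d}" "rl_right_exists c d \<gamma> f x"
  shows "rl_right c d \<gamma> f x = rl_left (- d) (- c) \<gamma> (\<lambda>t. f (- t)) (- x)"
  using rl_right_formula_uminus(2)[OF assms(1,2) _ assms(4)] assms(3) by (simp add: rl_right_def rl_left_def)

lemma rl_right_uminus:
  assumes "\<gamma> < 1" "c < d" "x \<in> {c..d}" "\<forall>x\<in>{c..<d}. rl_right_exists c d \<gamma> f x"
  shows "rl_right c d \<gamma> f x = rl_left (- d) (- c) \<gamma> (\<lambda>t. f (- t)) (- x)"
proof (cases "x = d")
  case True
  have ev: "\<forall>\<^sub>F x in at_left d. rl_right_formula c d \<gamma> f x =
      rl_left_formula (- d) (- c) \<gamma> (\<lambda>t. f (- t)) (- x)"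
    using eventually_at_left_real[OF assms(2)]
    by eventually_elim (use assms in \<open>auto intro!: rl_right_formula_uminus\<close>)
  \<comment> \<open>Near the base point the two formulas agree up to reflection, so they have the
    same limits. As \<open>Lim\<close> is a definite description, it takes the same value on both,
    convergent or not.\<close>
  have "(rl_right_formula c d \<gamma> f \<longlongrightarrow> l) (at_left d) \<longleftrightarrow>
      (rl_left_formula (- d) (- c) \<gamma> (\<lambda>t. f (- t)) \<longlongrightarrow> l) (at_right (- d))" for l
    using tendsto_cong[OF ev] by (simp add: filterlim_at_left_to_right)
  then show ?thesis using True by (simp add: rl_right_def rl_left_def Topological_Spaces.Lim_def)
next
  case False
  then show ?thesis
    using rl_right_uminus_interior[OF assms(1,2), of x f] assms(3,4) by simp
qed

lemma rl_right_continuous_uminus: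
  assumes "\<gamma> < 1" "c < d"
  shows "rl_right_continuous c d \<gamma> f \<longleftrightarrow> rl_left_continuous (- d) (- c) \<gamma> (\<lambda>t. f (- t))"
proof -
  let ?f = "\<lambda>t. f (- t)"
  have ex: "(\<forall>x\<in>{c..<d}. rl_right_exists c d \<gamma> f x) \<longleftrightarrow>
      (\<forall>x\<in>{-d<..-c}. rl_left_exists (- d) (- c) \<gamma> ?f x)"
  proof -
    have "{-d<..-c} = uminus ` {c..<d}" by (auto simp: image_iff intro!: bexI[of _ "- x" for x])
    then show ?thesis unfolding \<open>{-d<..-c} = uminus ` {c..<d}\<close> ball_simps
      using rl_right_formula_uminus(1)[OF assms] by simp
  qed
  \<comment> \<open>Continuity is transferred under the assumption of existence, because only then
    are the values known to correspond.\<close>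
  have "continuous_on {c..d} (rl_right c d \<gamma> f) \<longleftrightarrow>
      continuous_on {-d..-c} (rl_left (- d) (- c) \<gamma> ?f)"
    if E: "\<forall>x\<in>{c..<d}. rl_right_exists c d \<gamma> f x"
  proof -
    have eq: "rl_right c d \<gamma> f x = rl_left (- d) (- c) \<gamma> ?f (- x)" if "x \<in> {c..d}" for x
      using rl_right_uminus[OF assms that, of f] E that by auto
    then have eq': "rl_left (- d) (- c) \<gamma> ?f x = rl_right c d \<gamma> f (- x)" if "x \<in> {-d..-c}" for x
      using eq[of "- x"] that by auto
    have 1: "continuous_on {-d..-c} (\<lambda>x. rl_right c d \<gamma> f (- x))"
      if "continuous_on {c..d} (rl_right c d \<gamma> f)"
      by (rule continuous_on_compose2[OF that]) (auto intro!: continuous_intros)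
    have 2: "continuous_on {c..d} (\<lambda>x. rl_left (- d) (- c) \<gamma> ?f (- x))"
      if "continuous_on {-d..-c} (rl_left (- d) (- c) \<gamma> ?f)"
      by (rule continuous_on_compose2[OF that]) (auto intro!: continuous_intros)
    have 3: "continuous_on {c..d} (rl_right c d \<gamma> f) \<longleftrightarrow>
        continuous_on {c..d} (\<lambda>x. rl_left (- d) (- c) \<gamma> ?f (- x))"
      by (rule continuous_on_cong[OF refl eq])
    have 4: "continuous_on {-d..-c} (rl_left (- d) (- c) \<gamma> ?f) \<longleftrightarrow>
        continuous_on {-d..-c} (\<lambda>x. rl_right c d \<gamma> f (- x))"
      by (rule continuous_on_cong[OF refl eq'])
    show ?thesis using 1 2 unfolding 3 4 by blast
  qed
  with ex show ?thesis unfolding rl_right_continuous_def rl_left_continuous_def by blast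
qed

text \<open>It suffices to exhibit a candidate \<open>D\<close> that is continuous up to the base
  point: the derivative is checked away from \<open>c\<close>, and continuity of \<open>D\<close>
  then supplies the limit by which \<open>rl_left\<close> is defined at \<open>c\<close>.\<close>

lemma rl_left_continuous_eqI:
  assumes "\<gamma> < 1" "c < d"
    and D: "\<And>x. x \<in> {c<..d} \<Longrightarrow> (rl_left_int c \<gamma> f has_vector_derivative Gamma (1 - \<gamma>) * D x) (at x within {c..d})"
    and cont: "continuous_on {c..d} D"
  shows "rl_left_continuous c d \<gamma> f" "x \<in> {c..d} \<Longrightarrow> rl_left c d \<gamma> f x = D x"
proof -
  have \<Gamma>: "Gamma (1 - \<gamma>) \<noteq> 0" using assms(1) by (simp add: Gamma_one_minus_nonzero)
  have form: "rl_left_exists c d \<gamma> f x" "rl_left_formula c d \<gamma> f x = D x" if "x \<in> {c<..d}" for x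
    using rl_left_existsI[OF D[OF that]] that assms(2) \<Gamma> by auto
  have "(D \<longlongrightarrow> D c) (at_right c)"
    using cont assms(2) unfolding continuous_on
    by (metis at_within_Icc_at_right atLeastAtMost_iff less_eq_real_def)
  moreover have "\<forall>\<^sub>F x in at_right c. D x = rl_left_formula c d \<gamma> f x"
    using eventually_at_right_real[OF assms(2)] by eventually_elim (simp add: form)
  ultimately have "(rl_left_formula c d \<gamma> f \<longlongrightarrow> D c) (at_right c)"
    using tendsto_cong by blast
  then have "Lim (at_right c) (rl_left_formula c d \<gamma> f) = D c"
    by (intro tendsto_Lim) auto
  then have eq: "rl_left c d \<gamma> f x = D x" if "x \<in> {c..d}" for x
    using that form by (auto simp: rl_left_def)
  have "continuous_on {c..d} (rl_left c d \<gamma> f)" using cont by (simp only: continuous_on_cong[OF refl eq])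
  then show "rl_left_continuous c d \<gamma> f" using form by (simp add: rl_left_continuous_def)
  show "rl_left c d \<gamma> f x = D x" if "x \<in> {c..d}" using eq that .
qed

lemma rl_left_int_deriv:
  assumes "\<gamma> < 1" "rl_left_continuous c d \<gamma> f" "x \<in> {c<..d}"
  shows "(rl_left_int c \<gamma> f has_vector_derivative Gamma (1 - \<gamma>) * rl_left c d \<gamma> f x) (at x within {c..d})"
  using rl_left_existsD[of c d \<gamma> f x] assms by (auto simp: rl_left_continuous_def rl_left_def)

text \<open>The combination has the shape \<open>y + s * h\<close> of a perturbation. Existence and
  continuity are part of the conclusion, since admissibility of the perturbed function depends on
  them.\<close>

lemma rl_left_add_cmult:
  assumes \<gamma>: "\<gamma> < 1" and "c < d" and f: "continuous_on {c..d} f" and g: "continuous_on {c..d} g"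
    and "rl_left_continuous c d \<gamma> f" "rl_left_continuous c d \<gamma> g"
  shows "rl_left_continuous c d \<gamma> (\<lambda>t. f t + k * g t)"
    "x \<in> {c..d} \<Longrightarrow> rl_left c d \<gamma> (\<lambda>t. f t + k * g t) x = rl_left c d \<gamma> f x + k * rl_left c d \<gamma> g x"
proof -
  let ?D = "\<lambda>x. rl_left c d \<gamma> f x + k * rl_left c d \<gamma> g x"
  \<comment> \<open>Splitting the singular integral requires both summands to be integrable; this is
    where continuity of \<open>f\<close> and \<open>g\<close> enters.\<close>
  have lin: "rl_left_int c \<gamma> (\<lambda>t. f t + k * g t) x = rl_left_int c \<gamma> f x + k * rl_left_int c \<gamma> g x"
    if "x \<in> {c..d}" for x
  proof -
    have i: "(\<lambda>t. (x - t) powr - \<gamma> * f t) integrable_on {c..x}"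
      "(\<lambda>t. (x - t) powr - \<gamma> * g t) integrable_on {c..x}"
      using that by (intro integrable_rl_kernel_left \<gamma> continuous_on_subset[OF f] continuous_on_subset[OF g]; auto)+
    have "integral {c..x} (\<lambda>t. (x - t) powr - \<gamma> * (f t + k * g t)) =
        integral {c..x} (\<lambda>t. (x - t) powr - \<gamma> * f t + k * ((x - t) powr - \<gamma> * g t))"
      by (simp add: algebra_simps)
    also have "\<dots> = integral {c..x} (\<lambda>t. (x - t) powr - \<gamma> * f t) +
        integral {c..x} (\<lambda>t. k * ((x - t) powr - \<gamma> * g t))"
      using i(1) integrable_cmul[OF i(2), of k] by (intro integral_add) simp_all
    finally show ?thesis by (simp add: rl_left_int_def)
  qed
  have "(rl_left_int c \<gamma> (\<lambda>t. f t + k * g t) has_vector_derivative Gamma (1 - \<gamma>) * ?D x) (at x within {c..d})"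
    if "x \<in> {c<..d}" for x
  proof (rule has_vector_derivative_transform[OF _ lin])
    show "((\<lambda>x. rl_left_int c \<gamma> f x + k * rl_left_int c \<gamma> g x) has_vector_derivative
       Gamma (1 - \<gamma>) * ?D x) (at x within {c..d})"
      using rl_left_int_deriv[OF \<gamma> assms(5) that] rl_left_int_deriv[OF \<gamma> assms(6) that]
      unfolding has_real_derivative_iff_has_vector_derivative[symmetric]
      by (auto intro!: derivative_eq_intros simp: algebra_simps)
  qed (use that in auto)
  moreover have "continuous_on {c..d} ?D"
    using assms by (intro continuous_intros) (auto simp: rl_left_continuous_def)
  ultimately show "rl_left_continuous c d \<gamma> (\<lambda>t. f t + k * g t)"
    "x \<in> {c..d} \<Longrightarrow> rl_left c d \<gamma> (\<lambda>t. f t + k * g t) x = ?D x"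
    using rl_left_continuous_eqI[OF \<gamma> \<open>c < d\<close>, of "\<lambda>t. f t + k * g t" ?D] by auto
qed

lemma rl_right_add_cmult:
  assumes \<gamma>: "\<gamma> < 1" and "c < d" and f: "continuous_on {c..d} f" and g: "continuous_on {c..d} g"
    and "rl_right_continuous c d \<gamma> f" "rl_right_continuous c d \<gamma> g"
  shows "rl_right_continuous c d \<gamma> (\<lambda>t. f t + k * g t)"
    "x \<in> {c..d} \<Longrightarrow> rl_right c d \<gamma> (\<lambda>t. f t + k * g t) x = rl_right c d \<gamma> f x + k * rl_right c d \<gamma> g x"
proof -
  have c: "continuous_on {-d..-c} (\<lambda>t. f (- t))" "continuous_on {-d..-c} (\<lambda>t. g (- t))"
    by (rule continuous_on_compose2[OF f] continuous_on_compose2[OF g]; auto intro!: continuous_intros)+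
  note * = rl_left_add_cmult[OF \<gamma> _ c, where k = k]
  show 1: "rl_right_continuous c d \<gamma> (\<lambda>t. f t + k * g t)"
    using *(1) assms(2,5,6) by (simp add: rl_right_continuous_uminus[OF \<gamma> \<open>c < d\<close>])
  have eq: "rl_right c d \<gamma> h x = rl_left (- d) (- c) \<gamma> (\<lambda>t. h (- t)) (- x)"
    if "rl_right_continuous c d \<gamma> h" "x \<in> {c..d}" for h x
    using rl_right_uminus[OF \<gamma> \<open>c < d\<close> that(2), of h] that(1) by (auto simp: rl_right_continuous_def)
  show "rl_right c d \<gamma> (\<lambda>t. f t + k * g t) x = rl_right c d \<gamma> f x + k * rl_right c d \<gamma> g x"
    if "x \<in> {c..d}"
    using *(2)[where x = "- x"] assms(2,5,6) that
    by (simp add: eq[OF _ that] 1 rl_right_continuous_uminus[OF \<gamma> \<open>c < d\<close>])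
qed

subsection \<open>Fractional derivatives of test functions\<close>

text \<open>Clipping at zero gives one formula on the whole line with support in
  \<open>{c..d}\<close> when \<open>c \<le> d\<close>; squaring makes the function continuously
  differentiable across \<open>c\<close> and \<open>d\<close>.\<close>

definition bump :: "real \<Rightarrow> real \<Rightarrow> real \<Rightarrow> real" where
  "bump c d x = (max 0 ((x - c) * (d - x)))\<^sup>2"

definition bump_deriv :: "real \<Rightarrow> real \<Rightarrow> real \<Rightarrow> real" where
  "bump_deriv c d x = 2 * max 0 ((x - c) * (d - x)) * (c + d - 2 * x)"

text \<open>Squaring removes the corner of \<open>max\<close>: at zero the difference quotient is at
  most \<open>\<bar>h\<bar>\<close> in absolute value.\<close>

lemma has_real_derivative_max_0_squared:
  "((\<lambda>z::real. (max 0 z)\<^sup>2) has_real_derivative 2 * max 0 z) (at z)"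
proof -
  consider "z < 0" | "z > 0" | "z = 0" by linarith
  then show ?thesis
  proof cases
    case 1
    have "((\<lambda>z::real. 0) has_real_derivative 0) (at z)" by simp
    then have "((\<lambda>z::real. (max 0 z)\<^sup>2) has_real_derivative 0) (at z)"
      by (rule has_field_derivative_transform_within_open[where S = "{..<0}"]) (use 1 in auto)
    then show ?thesis using 1 by simp
  next
    case 2
    have "((\<lambda>z::real. z\<^sup>2) has_real_derivative 2 * z) (at z)"
      by (auto intro!: derivative_eq_intros)
    then have "((\<lambda>z::real. (max 0 z)\<^sup>2) has_real_derivative 2 * z) (at z)"
      by (rule has_field_derivative_transform_within_open[where S = "{0<..}"]) (use 2 in auto)
    then show ?thesis using 2 by simp
  next
    case 3
    have "((\<lambda>h::real. (max 0 h)\<^sup>2 / h) \<longlongrightarrow> 0) (at 0)"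
    proof (rule Lim_null_comparison)
      show "\<forall>\<^sub>F h::real in at 0. norm ((max 0 h)\<^sup>2 / h) \<le> \<bar>h\<bar>"
        by (rule eventuallyI) (auto simp: max_def power2_eq_square)
      show "((\<lambda>h::real. \<bar>h\<bar>) \<longlongrightarrow> 0) (at 0)" by (auto intro!: tendsto_eq_intros)
    qed
    then show ?thesis using 3 by (simp add: has_field_derivative_iff)
  qed
qed

lemma bump_has_deriv: "(bump c d has_real_derivative bump_deriv c d x) (at x)"
proof -
  have "((\<lambda>x. (x - c) * (d - x)) has_real_derivative (c + d - 2 * x)) (at x)"
    by (auto intro!: derivative_eq_intros)
  from DERIV_chain2[OF has_real_derivative_max_0_squared this]
  show ?thesis by (simp add: bump_def[abs_def] bump_deriv_def)
qed

lemma continuous_on_bump [continuous_intros]: "continuous_on S (bump c d)"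
  unfolding bump_def[abs_def] by (intro continuous_intros)

lemma continuous_on_bump_deriv [continuous_intros]: "continuous_on S (bump_deriv c d)"
  unfolding bump_deriv_def[abs_def] by (intro continuous_intros)

lemma bump_eq_0:
  assumes "c \<le> d" "x \<notin> {c<..<d}"
  shows "bump c d x = 0" "bump_deriv c d x = 0"
proof -
  have "(x - c) * (d - x) \<le> 0"
    using assms by (intro mult_le_0_iff[THEN iffD2]) auto
  then show "bump c d x = 0" "bump_deriv c d x = 0" by (auto simp: bump_def bump_deriv_def)
qed

lemma bump_pos: "x \<in> {c<..<d} \<Longrightarrow> 0 < bump c d x"
  by (simp add: bump_def)

lemma bump_uminus: "bump c d (- x) = bump (- d) (- c) x"
proof -
  have "(- x - c) * (d - - x) = (x - - d) * (- c - x)" by (simp add: algebra_simps)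
  then show ?thesis by (simp add: bump_def)
qed

text \<open>
  As \<open>g\<close> vanishes left of \<open>a\<close>, the substitution can be made on an interval of fixed length, so that
  \<open>x\<close> occurs only inside \<open>g\<close> and one can differentiate under the integral.
\<close>
lemma rl_left_int_eq_regular:
  assumes \<gamma>: "\<gamma> < 1" and g: "continuous_on UNIV g" "\<And>t. t \<le> a \<Longrightarrow> g t = 0" and x: "x \<in> {a..b}"
  shows "rl_left_int a \<gamma> g x =
    1 / (1 - \<gamma>) * integral {0..(b - a) powr (1 - \<gamma>)} (\<lambda>r. g (x - r powr (1 / (1 - \<gamma>))))"
proof -
  have "rl_left_int a \<gamma> g x = integral {x - (b - a)..x} (\<lambda>t. (x - t) powr (- \<gamma>) * g t)"
    unfolding rl_left_int_def
  proof (rule integral_spike_set)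
    have "{t \<in> {a..x} - {x - (b - a)..x}. (x - t) powr (- \<gamma>) * g t \<noteq> 0} = {}"
      "{t \<in> {x - (b - a)..x} - {a..x}. (x - t) powr (- \<gamma>) * g t \<noteq> 0} = {}"
      using x g(2) by (auto simp: not_le)
    then show "negligible {t \<in> {a..x} - {x - (b - a)..x}. (x - t) powr (- \<gamma>) * g t \<noteq> 0}"
      "negligible {t \<in> {x - (b - a)..x} - {a..x}. (x - t) powr (- \<gamma>) * g t \<noteq> 0}"
      by (simp_all only: negligible_empty)
  qed
  also have "\<dots> = 1 / (1 - \<gamma>) * integral {0..(b - a) powr (1 - \<gamma>)} (\<lambda>r. g (x - r powr (1 / (1 - \<gamma>))))"
    using has_integral_rl_kernel_left[OF \<gamma>, of "x - (b - a)" x g] x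
      continuous_on_subset[OF g(1)] by (simp add: has_integral_iff)
  finally show ?thesis .
qed

text \<open>After the substitution, differentiation under the integral falls on \<open>g\<close>
  alone, and undoing the substitution turns the result into the fractional integral of
  \<open>g'\<close>. In other words, for such functions the Riemann-Liouville derivative agrees with
  the Caputo derivative.\<close>

lemma rl_left_smooth:
  assumes \<gamma>: "\<gamma> < 1" and "a < b"
    and g: "\<And>t. (g has_real_derivative g' t) (at t)" "continuous_on UNIV g'"
    and 0: "\<And>t. t \<le> a \<Longrightarrow> g t = 0" "\<And>t. t \<le> a \<Longrightarrow> g' t = 0"
  shows "rl_left_continuous a b \<gamma> g"
    and "x \<in> {a..b} \<Longrightarrow> rl_left a b \<gamma> g x = rl_left_int a \<gamma> g' x / Gamma (1 - \<gamma>)"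
proof -
  \<comment> \<open>\<open>\<rho>\<close> and \<open>\<kappa>\<close> are the upper limit and the
    exponent of the substituted integral; neither depends on \<open>x\<close>.\<close>
  define \<rho> where "\<rho> = (b - a) powr (1 - \<gamma>)"
  define \<kappa> where "\<kappa> = 1 / (1 - \<gamma>)"
  have \<kappa>: "\<kappa> > 0" using \<gamma> by (simp add: \<kappa>_def)
  define D where "D x = \<kappa> * integral {0..\<rho>} (\<lambda>r. g' (x - r powr \<kappa>)) / Gamma (1 - \<gamma>)" for x
  have g_cont: "continuous_on UNIV g"
    using g(1) by (intro DERIV_continuous_on) (auto intro: has_field_derivative_at_within)
  have cont2: "continuous_on (UNIV \<times> cbox 0 \<rho>) (\<lambda>(x, r). f (x - r powr \<kappa>))"
    if "continuous_on UNIV f" for f :: "real \<Rightarrow> real"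
    unfolding split_beta using \<kappa>
    by (intro continuous_on_compose2[OF that] continuous_intros continuous_on_powr') auto
  have cont1: "continuous_on (cbox 0 \<rho>) (\<lambda>r. f (x - r powr \<kappa>))"
    if "continuous_on UNIV f" for f :: "real \<Rightarrow> real" and x
    using \<kappa> by (intro continuous_on_compose2[OF that] continuous_intros continuous_on_powr') auto
  have \<Gamma>: "Gamma (1 - \<gamma>) \<noteq> 0" by (rule Gamma_one_minus_nonzero[OF \<gamma>])
  have "((\<lambda>x. integral (cbox 0 \<rho>) (\<lambda>r. g (x - r powr \<kappa>))) has_field_derivative
      integral (cbox 0 \<rho>) (\<lambda>r. g' (x - r powr \<kappa>))) (at x)" for x
  proof (rule leibniz_rule_field_derivative[where U = UNIV])
    show "((\<lambda>x. g (x - r powr \<kappa>)) has_real_derivative g' (x - r powr \<kappa>)) (at x)" for x r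
    proof -
      have "((\<lambda>x. x - r powr \<kappa>) has_real_derivative 1) (at x)"
        by (auto intro!: derivative_eq_intros)
      from DERIV_chain2[OF g(1) this] show ?thesis by simp
    qed
    show "(\<lambda>r. g (x - r powr \<kappa>)) integrable_on cbox 0 \<rho>" for x
      by (intro integrable_continuous cont1 g_cont)
    show "continuous_on (UNIV \<times> cbox 0 \<rho>) (\<lambda>(x, r). g' (x - r powr \<kappa>))"
      by (rule cont2[OF g(2)])
  qed auto
  then have der: "((\<lambda>x. \<kappa> * integral {0..\<rho>} (\<lambda>r. g (x - r powr \<kappa>))) has_real_derivative
      Gamma (1 - \<gamma>) * D x) (at x)" for x
    using \<Gamma> by (auto simp: D_def intro!: DERIV_cmult)
  have dD: "(rl_left_int a \<gamma> g has_vector_derivative Gamma (1 - \<gamma>) * D x) (at x within {a..b})"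
    if x: "x \<in> {a<..b}" for x
  proof (rule has_vector_derivative_transform)
    show "x \<in> {a..b}" using x by auto
    show "rl_left_int a \<gamma> g t = \<kappa> * integral {0..\<rho>} (\<lambda>r. g (t - r powr \<kappa>))" if "t \<in> {a..b}" for t
      unfolding \<kappa>_def \<rho>_def by (rule rl_left_int_eq_regular[OF \<gamma> g_cont 0(1) that])
    show "((\<lambda>x. \<kappa> * integral {0..\<rho>} (\<lambda>r. g (x - r powr \<kappa>))) has_vector_derivative
        Gamma (1 - \<gamma>) * D x) (at x within {a..b})"
      using der[of x] has_field_derivative_at_within
      by (simp add: has_real_derivative_iff_has_vector_derivative[symmetric])
  qed
  have "continuous_on UNIV (\<lambda>x. integral (cbox 0 \<rho>) (\<lambda>r. g' (x - r powr \<kappa>)))"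
    by (rule integral_continuous_on_param[OF cont2[OF g(2)]])
  then have "continuous_on {a..b} D"
    unfolding D_def using \<Gamma> by (auto intro!: continuous_intros intro: continuous_on_subset)
  note * = rl_left_continuous_eqI[OF \<gamma> \<open>a < b\<close> dD this]
  show "rl_left_continuous a b \<gamma> g" by (rule *)
  show "rl_left a b \<gamma> g x = rl_left_int a \<gamma> g' x / Gamma (1 - \<gamma>)" if "x \<in> {a..b}"
    using *(2)[OF _ that] rl_left_int_eq_regular[OF \<gamma> g(2) 0(2) that]
    by (simp add: D_def \<kappa>_def \<rho>_def)
qed

lemma rl_left_bump:
  assumes "\<gamma> < 1" "a \<le> c" "c \<le> d" "a < b"
  shows "rl_left_continuous a b \<gamma> (bump c d)"
    and "x \<in> {a..b} \<Longrightarrow> rl_left a b \<gamma> (bump c d) x = rl_left_int a \<gamma> (bump_deriv c d) x / Gamma (1 - \<gamma>)"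
  using rl_left_smooth[OF assms(1,4) bump_has_deriv continuous_on_bump_deriv, of c d] assms bump_eq_0
  by auto

text \<open>A left derivative at \<open>x\<close> sees only values to the left of \<open>x\<close>,
  where the test function is still zero. This removes the \<open>u\<close>-term for test functions
  supported to the right of \<open>B\<close>.\<close>

lemma rl_left_bump_eq_0:
  assumes "\<gamma> < 1" "a \<le> c" "c \<le> d" "a < b" "x \<in> {a..b}" "x \<le> c"
  shows "rl_left a b \<gamma> (bump c d) x = 0"
proof -
  have "rl_left_int a \<gamma> (bump_deriv c d) x = integral {a..x} (\<lambda>t. 0)"
    unfolding rl_left_int_def using assms by (intro integral_cong) (simp add: bump_eq_0)
  then show ?thesis using rl_left_bump(2)[OF assms(1-5)] by simp
qed

section \<open>Fractional integration by parts against test functions\<close>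

text \<open>Fubini moves the kernel from the derivative of the test function onto \<open>p\<close>,
  and an ordinary integration by parts then moves that derivative. The function \<open>R\<close> is
  left open because \<open>max A t\<close> resolves differently inside \<open>{A..B}\<close> and to
  the left of \<open>A\<close>.\<close>

lemma rl_left_bump_pairing:
  assumes \<gamma>: "\<gamma> < 1" and AB: "a \<le> A" "A < B" "B \<le> b" and cd: "a \<le> c" "c < d" "d \<le> b"
    and p: "continuous_on {A..B} p"
    and W: "\<And>t. t \<in> {c..d} \<Longrightarrow>
      ((\<lambda>t. integral {max A t..B} (\<lambda>x. (x - t) powr (- \<gamma>) * p x)) has_real_derivative
        - Gamma (1 - \<gamma>) * R t) (at t)"
    and R: "continuous_on {c..d} R"
  shows "integral {A..B} (\<lambda>x. p x * rl_left a b \<gamma> (bump c d) x) = integral {c..d} (\<lambda>t. bump c d t * R t)"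
proof -
  define V where "V t = integral {max A t..B} (\<lambda>x. (x - t) powr (- \<gamma>) * p x)" for t
  let ?\<Gamma> = "Gamma (1 - \<gamma>)"
  have \<Gamma>: "?\<Gamma> \<noteq> 0" by (rule Gamma_one_minus_nonzero[OF \<gamma>])
  have V: "(V has_real_derivative - ?\<Gamma> * R t) (at t)" if "t \<in> {c..d}" for t
    unfolding V_def[abs_def] using W[OF that] .
  have "integral {A..B} (\<lambda>x. p x * rl_left a b \<gamma> (bump c d) x) =
      integral {A..B} (\<lambda>x. p x * integral {a..x} (\<lambda>t. (x - t) powr (- \<gamma>) * bump_deriv c d t) / ?\<Gamma>)"
    using AB cd \<gamma> by (intro integral_cong) (simp add: rl_left_bump(2) rl_left_int_def)
  also have "\<dots> = integral {A..B} (\<lambda>x. p x * integral {a..x} (\<lambda>t. (x - t) powr (- \<gamma>) * bump_deriv c d t)) / ?\<Gamma>"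
    by simp
  also have "integral {A..B} (\<lambda>x. p x * integral {a..x} (\<lambda>t. (x - t) powr (- \<gamma>) * bump_deriv c d t)) =
      integral {a..b} (\<lambda>t. bump_deriv c d t * V t)"
    unfolding V_def using AB
    by (intro rl_kernel_integral_swap \<gamma> p continuous_intros) auto
  also have "\<dots> = integral {c..d} (\<lambda>t. bump_deriv c d t * V t)"
  proof (rule integral_spike_set)
    have "bump_deriv c d t = 0" if "t \<notin> {c..d}" for t
      using that cd by (intro bump_eq_0) auto
    then have "{t \<in> {a..b} - {c..d}. bump_deriv c d t * V t \<noteq> 0} = {}"
      "{t \<in> {c..d} - {a..b}. bump_deriv c d t * V t \<noteq> 0} = {}"
      using cd by auto
    then show "negligible {t \<in> {a..b} - {c..d}. bump_deriv c d t * V t \<noteq> 0}"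
      "negligible {t \<in> {c..d} - {a..b}. bump_deriv c d t * V t \<noteq> 0}"
      by (simp_all only: negligible_empty)
  qed
  also have "((\<lambda>t. bump_deriv c d t * V t) has_integral
      ?\<Gamma> * integral {c..d} (\<lambda>t. bump c d t * R t)) {c..d}"
  \<comment> \<open>The boundary terms vanish because the test function is zero at \<open>c\<close>
    and at \<open>d\<close>.\<close>
  proof (rule integration_by_parts[OF bounded_bilinear_mult])
    show "c \<le> d" using cd by simp
    show "continuous_on {c..d} (bump c d)" by (intro continuous_intros)
    show "continuous_on {c..d} V"
      using V by (intro DERIV_continuous_on) (auto intro: has_field_derivative_at_within)
    show "(bump c d has_vector_derivative bump_deriv c d t) (at t)" for t
      using bump_has_deriv by (simp add: has_real_derivative_iff_has_vector_derivative)
    show "(V has_vector_derivative - ?\<Gamma> * R t) (at t)" if "t \<in> {c..d}" for t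
      using V[OF that] by (simp add: has_real_derivative_iff_has_vector_derivative)
    have "(\<lambda>t. bump c d t * R t) integrable_on {c..d}"
      using R by (intro integrable_continuous_real continuous_intros)
    then have "((\<lambda>t. - ?\<Gamma> * (bump c d t * R t)) has_integral
        - ?\<Gamma> * integral {c..d} (\<lambda>t. bump c d t * R t)) {c..d}"
      by (intro has_integral_mult_right integrable_integral)
    then show "((\<lambda>t. bump c d t * (- ?\<Gamma> * R t)) has_integral
      bump c d d * V d - bump c d c * V c - ?\<Gamma> * integral {c..d} (\<lambda>t. bump c d t * R t)) {c..d}"
      using cd by (simp add: bump_eq_0 mult_ac)
  qed
  then have "integral {c..d} (\<lambda>t. bump_deriv c d t * V t) = ?\<Gamma> * integral {c..d} (\<lambda>t. bump c d t * R t)"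
    by (rule integral_unique)
  finally show ?thesis using \<Gamma> by simp
qed

section \<open>Moving the base point of a fractional derivative\<close>

text \<open>For \<open>t < e\<close> the fractional integrals with base points \<open>b\<close> and
  \<open>e\<close> differ by an integral over \<open>{e..b}\<close> whose kernel is smooth in
  \<open>t\<close>, so differentiability passes from one to the other. The conclusions stop short of
  \<open>e\<close>, where that kernel may become singular.\<close>

lemma rl_right_truncate:
  assumes \<gamma>: "\<gamma> < 1" and e: "a < e" "e \<le> b" and p: "continuous_on {a..b} p"
    and rc: "rl_right_continuous a b \<gamma> p"
  shows "t \<in> {a<..<e} \<Longrightarrow>
      (rl_right_int e \<gamma> p has_real_derivative - Gamma (1 - \<gamma>) * rl_right a e \<gamma> p t) (at t)"
    and "t \<in> {a<..<e} \<Longrightarrow> rl_right_exists a e \<gamma> p t"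
    and "continuous_on {a<..<e} (rl_right a e \<gamma> p)"
proof -
  let ?\<Gamma> = "Gamma (1 - \<gamma>)"
  have \<Gamma>: "?\<Gamma> \<noteq> 0" by (rule Gamma_one_minus_nonzero[OF \<gamma>])
  \<comment> \<open>\<open>T\<close> is the part of the integral cut off by the new base point, and
    \<open>T'\<close> its derivative, taken under the integral.\<close>
  define T where "T t = integral (cbox e b) (\<lambda>x. (x - t) powr (- \<gamma>) * p x)" for t
  define T' where "T' t = integral (cbox e b) (\<lambda>x. \<gamma> * (x - t) powr (- \<gamma> - 1) * p x)" for t
  have pe: "continuous_on {e..b} p" using e by (intro continuous_on_subset[OF p]) auto
  have pe2: "continuous_on ({..<e} \<times> {e..b}) (\<lambda>z. p (snd z))"
    by (rule continuous_on_compose2[OF pe]) (auto intro!: continuous_intros)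
  have T'cont2: "continuous_on ({..<e} \<times> cbox e b) (\<lambda>(t, x). \<gamma> * (x - t) powr (- \<gamma> - 1) * p x)"
    unfolding split_beta by (intro continuous_intros) (use pe2 in auto)
  have T: "(T has_real_derivative T' t) (at t within {..<e})" if "t < e" for t
    unfolding T_def T'_def
  proof (rule leibniz_rule_field_derivative[where U = "{..<e}", OF _ _ T'cont2])
    fix t x assume tx: "t \<in> {..<e}" "x \<in> cbox e b"
    have "((\<lambda>t. (x - t) powr (- \<gamma>)) has_real_derivative - \<gamma> * (x - t) powr (- \<gamma> - 1) * (- 1)) (at t)"
      using tx by (intro DERIV_chain2[OF has_real_derivative_powr] derivative_eq_intros) auto
    from DERIV_cmult_right[OF this, of "p x"]
    show "((\<lambda>t. (x - t) powr (- \<gamma>) * p x) has_real_derivative \<gamma> * (x - t) powr (- \<gamma> - 1) * p x)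
        (at t within {..<e})"
      by (simp add: has_field_derivative_at_within)
  next
    fix t assume "t \<in> {..<e}"
    then show "(\<lambda>x. (x - t) powr (- \<gamma>) * p x) integrable_on cbox e b"
      by (intro integrable_continuous continuous_intros) (use pe in auto)
  qed (use that in auto)
  have T'cont: "continuous_on {..<e} T'"
    unfolding T'_def by (rule integral_continuous_on_param[OF T'cont2])
  \<comment> \<open>The derivative of the integral based at \<open>b\<close>, minus the derivative
    of the part cut off.\<close>
  define R where "R t = - ?\<Gamma> * rl_right a b \<gamma> p t - T' t" for t
  have split: "rl_right_int b \<gamma> p t - T t = rl_right_int e \<gamma> p t" if "t \<in> {a<..<e}" for t
  proof -
    have "(\<lambda>x. (x - t) powr (- \<gamma>) * p x) integrable_on {t..b}"
      using that e by (intro integrable_rl_kernel_right \<gamma> continuous_on_subset[OF p]) auto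
    from Henstock_Kurzweil_Integration.integral_combine[OF _ _ this, of e] that e show ?thesis
      by (simp add: T_def rl_right_int_def)
  qed
  have D: "(rl_right_int e \<gamma> p has_real_derivative R t) (at t)" if t: "t \<in> {a<..<e}" for t
  proof (rule has_field_derivative_transform_within_open)
    have ex: "rl_right_exists a b \<gamma> p t" using rc t e by (simp add: rl_right_continuous_def)
    have "(rl_right_int b \<gamma> p has_vector_derivative - ?\<Gamma> * rl_right_formula a b \<gamma> p t) (at t within {a..b})"
      using rl_right_existsD[OF ex _ _ \<gamma>] t e by simp
    moreover have "at t within {a..b} = at t" using t e by (intro at_within_interior) auto
    moreover have "at t within {..<e} = at t" using t by (intro at_within_open) auto
    ultimately show "((\<lambda>t. rl_right_int b \<gamma> p t - T t) has_real_derivative R t) (at t)"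
      using T[of t] t e unfolding R_def
      by (intro DERIV_diff) (auto simp: rl_right_def has_real_derivative_iff_has_vector_derivative)
    show "rl_right_int b \<gamma> p x - T x = rl_right_int e \<gamma> p x" if "x \<in> {a<..<e}" for x
      using split[OF that] .
  qed (use t in auto)
  have I: "rl_right_exists a e \<gamma> p t" "rl_right_formula a e \<gamma> p t = - R t / ?\<Gamma>" if t: "t \<in> {a<..<e}" for t
    using rl_right_existsI[of e \<gamma> p "R t" t a] D[OF t] t e
    by (auto simp: has_real_derivative_iff_has_vector_derivative has_vector_derivative_at_within)
  then show "rl_right_exists a e \<gamma> p t" if "t \<in> {a<..<e}" using that by blast
  have eq: "rl_right a e \<gamma> p t = - R t / ?\<Gamma>" if "t \<in> {a<..<e}" for t
    using I(2)[OF that] that by (simp add: rl_right_def)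
  then show "(rl_right_int e \<gamma> p has_real_derivative - ?\<Gamma> * rl_right a e \<gamma> p t) (at t)"
    if "t \<in> {a<..<e}" using D[OF that] that \<Gamma> by simp
  have "continuous_on {a<..<e} (rl_right a b \<gamma> p)"
    using rc e by (auto simp: rl_right_continuous_def elim!: continuous_on_subset)
  then have "continuous_on {a<..<e} (\<lambda>t. - R t / ?\<Gamma>)"
    unfolding R_def using \<Gamma> by (intro continuous_intros continuous_on_subset[OF T'cont]) auto
  then show "continuous_on {a<..<e} (rl_right a e \<gamma> p)"
    by (simp only: continuous_on_cong[OF refl eq])
qed

text \<open>For \<open>t > A\<close> the lower limit \<open>max A t\<close> is \<open>t\<close>
  itself, so near \<open>{c..d}\<close> the integral in question is the right fractional integral
  based at \<open>B\<close>.\<close>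

lemma rl_left_bump_pairing_inner:
  assumes \<gamma>: "\<gamma> < 1" and AB: "a \<le> A" "A < c" "c < d" "d < B" "B \<le> b"
    and p: "continuous_on {a..b} p" "rl_right_continuous a b \<gamma> p"
  shows "integral {A..B} (\<lambda>x. p x * rl_left a b \<gamma> (bump c d) x) =
    integral {c..d} (\<lambda>t. bump c d t * rl_right a B \<gamma> p t)"
proof (rule rl_left_bump_pairing[OF \<gamma>])
  have aB: "a < B" using AB by linarith
  note tr = rl_right_truncate[OF \<gamma> aB AB(5) p]
  show "continuous_on {c..d} (rl_right a B \<gamma> p)"
    by (rule continuous_on_subset[OF tr(3)]) (use AB in auto)
  show "((\<lambda>t. integral {max A t..B} (\<lambda>x. (x - t) powr (- \<gamma>) * p x)) has_real_derivative
        - Gamma (1 - \<gamma>) * rl_right a B \<gamma> p t) (at t)" if "t \<in> {c..d}" for t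
  proof (rule has_field_derivative_transform_within_open)
    show "(rl_right_int B \<gamma> p has_real_derivative - Gamma (1 - \<gamma>) * rl_right a B \<gamma> p t) (at t)"
      using tr(1)[of t] that AB by auto
    show "t \<in> {A<..}" using that AB by auto
    show "rl_right_int B \<gamma> p t = integral {max A t..B} (\<lambda>x. (x - t) powr (- \<gamma>) * p x)"
      if "t \<in> {A<..}" for t using that by (simp add: rl_right_int_def max_def)
  qed auto
qed (use AB in \<open>auto intro!: continuous_on_subset[OF p(1)]\<close>)

text \<open>For \<open>t < A\<close> the integration over \<open>x\<close> starts at
  \<open>A\<close> and misses the stretch from \<open>t\<close> to \<open>A\<close>; what remains is
  the fractional integral based at \<open>B\<close> minus the one based at \<open>A\<close>. This is
  the origin of the difference in the equation on \<open>{a..A}\<close>.\<close>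

lemma rl_left_bump_pairing_outer:
  assumes \<gamma>: "\<gamma> < 1" and AB: "a < c" "c < d" "d < A" "A < B" "B \<le> b"
    and p: "continuous_on {a..b} p" "rl_right_continuous a b \<gamma> p"
  shows "integral {A..B} (\<lambda>x. p x * rl_left a b \<gamma> (bump c d) x) =
    integral {c..d} (\<lambda>t. bump c d t * (rl_right a B \<gamma> p t - rl_right a A \<gamma> p t))"
proof (rule rl_left_bump_pairing[OF \<gamma>])
  have aB: "a < B" "a < A" "A \<le> b" using AB by linarith+
  note trB = rl_right_truncate[OF \<gamma> aB(1) AB(5) p]
  note trA = rl_right_truncate[OF \<gamma> aB(2,3) p]
  show "continuous_on {c..d} (\<lambda>t. rl_right a B \<gamma> p t - rl_right a A \<gamma> p t)"
    by (intro continuous_intros continuous_on_subset[OF trA(3)] continuous_on_subset[OF trB(3)])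
      (use AB in auto)
  show "((\<lambda>t. integral {max A t..B} (\<lambda>x. (x - t) powr (- \<gamma>) * p x)) has_real_derivative
        - Gamma (1 - \<gamma>) * (rl_right a B \<gamma> p t - rl_right a A \<gamma> p t)) (at t)" if "t \<in> {c..d}" for t
  proof (rule has_field_derivative_transform_within_open)
    show "((\<lambda>t. rl_right_int B \<gamma> p t - rl_right_int A \<gamma> p t) has_real_derivative
        - Gamma (1 - \<gamma>) * (rl_right a B \<gamma> p t - rl_right a A \<gamma> p t)) (at t)"
      using DERIV_diff[OF trB(1)[of t] trA(1)[of t]] that AB by (auto simp: algebra_simps)
    show "t \<in> {a<..<A}" using that AB by auto
    show "rl_right_int B \<gamma> p t - rl_right_int A \<gamma> p t =
        integral {max A t..B} (\<lambda>x. (x - t) powr (- \<gamma>) * p x)"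
      if t: "t \<in> {a<..<A}" for t
    proof -
      have "(\<lambda>x. (x - t) powr (- \<gamma>) * p x) integrable_on {t..B}"
        using t AB by (intro integrable_rl_kernel_right \<gamma> continuous_on_subset[OF p(1)]) auto
      from Henstock_Kurzweil_Integration.integral_combine[OF _ _ this, of A] t AB show ?thesis
        by (simp add: rl_right_int_def max_def)
    qed
  qed auto
qed (use AB in \<open>auto intro!: continuous_on_subset[OF p(1)]\<close>)

section \<open>Right-sided counterparts by reflection\<close>

lemma rl_right_bump_continuous:
  assumes "\<gamma> < 1" "d \<le> b" "c \<le> d" "a < b"
  shows "rl_right_continuous a b \<gamma> (bump c d)"
  using rl_left_bump(1)[of \<gamma> "- b" "- d" "- c" "- a"] assms
  by (simp add: rl_right_continuous_uminus bump_uminus)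

lemma rl_right_bump_uminus:
  assumes "\<gamma> < 1" "d \<le> b" "c \<le> d" "a < b" "x \<in> {a..b}"
  shows "rl_right a b \<gamma> (bump c d) x = rl_left (- b) (- a) \<gamma> (bump (- d) (- c)) (- x)"
  using rl_right_uminus[OF assms(1,4,5), of "bump c d"] rl_right_bump_continuous[OF assms(1-4)]
  by (simp add: rl_right_continuous_def bump_uminus)

lemma rl_right_bump_eq_0:
  assumes "\<gamma> < 1" "d \<le> b" "c \<le> d" "a < b" "x \<in> {a..b}" "d \<le> x"
  shows "rl_right a b \<gamma> (bump c d) x = 0"
  using rl_left_bump_eq_0[of \<gamma> "- b" "- d" "- c" "- a" "- x"] assms
  by (simp add: rl_right_bump_uminus)

text \<open>The mirror image of the truncation of right derivatives. The last two conclusions record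
  what the reflected function satisfies, for use in the reflected pairings.\<close>

lemma rl_left_truncate:
  assumes \<gamma>: "\<gamma> < 1" and e: "a \<le> e" "e < b" and q: "continuous_on {a..b} q"
    and lc: "rl_left_continuous a b \<gamma> q"
  shows "t \<in> {e<..<b} \<Longrightarrow> rl_left_exists e b \<gamma> q t"
    and "t \<in> {e<..<b} \<Longrightarrow> rl_left e b \<gamma> q t = rl_right (- b) (- e) \<gamma> (\<lambda>t. q (- t)) (- t)"
    and "continuous_on {e<..<b} (rl_left e b \<gamma> q)"
    and "continuous_on {- b..- a} (\<lambda>t. q (- t))" "rl_right_continuous (- b) (- a) \<gamma> (\<lambda>t. q (- t))"
proof -
  let ?q = "\<lambda>t. q (- t)"
  show q': "continuous_on {- b..- a} ?q"
    by (rule continuous_on_compose2[OF q]) (auto intro!: continuous_intros)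
  show rc: "rl_right_continuous (- b) (- a) \<gamma> ?q"
    using lc e by (simp add: rl_right_continuous_uminus[OF \<gamma>])
  have e': "- b < - e" "- e \<le> - a" using e by auto
  note tr = rl_right_truncate[OF \<gamma> e' q' rc]
  have ex: "rl_right_exists (- b) (- e) \<gamma> ?q (- t)" if "t \<in> {e<..<b}" for t
    using tr(2)[of "- t"] that by simp
  show "rl_left_exists e b \<gamma> q t" if "t \<in> {e<..<b}"
    using rl_right_formula_uminus(1)[OF \<gamma> e'(1), of "- t" ?q] ex[OF that] that by simp
  show eq: "rl_left e b \<gamma> q t = rl_right (- b) (- e) \<gamma> ?q (- t)" if "t \<in> {e<..<b}" for t
    using rl_right_uminus_interior[OF \<gamma> e'(1) _ ex[OF that]] that by simp
  have "continuous_on {e<..<b} (\<lambda>t. rl_right (- b) (- e) \<gamma> ?q (- t))"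
    by (rule continuous_on_compose2[OF tr(3)]) (auto intro!: continuous_intros)
  then show "continuous_on {e<..<b} (rl_left e b \<gamma> q)"
    by (simp only: continuous_on_cong[OF refl eq])
qed

text \<open>Reflecting the domain of integration together with the test function reduces pairings
  with right derivatives to left-sided ones.\<close>

lemma rl_right_bump_pairing_uminus:
  assumes "\<gamma> < 1" "a \<le> A" "A < B" "B \<le> b" "c \<le> d" "d \<le> b"
  shows "integral {A..B} (\<lambda>x. q x * rl_right a b \<gamma> (bump c d) x) =
    integral {- B..- A} (\<lambda>x. q (- x) * rl_left (- b) (- a) \<gamma> (bump (- d) (- c)) x)"
proof -
  have "integral {A..B} (\<lambda>x. q x * rl_right a b \<gamma> (bump c d) x) =
      integral {A..B} (\<lambda>x. q x * rl_left (- b) (- a) \<gamma> (bump (- d) (- c)) (- x))"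
    using assms by (intro integral_cong) (simp add: rl_right_bump_uminus)
  also have "\<dots> = integral {- B..- A} (\<lambda>x. q (- x) * rl_left (- b) (- a) \<gamma> (bump (- d) (- c)) x)"
    using Henstock_Kurzweil_Integration.integral_reflect_real
      [of B A "\<lambda>x. q x * rl_left (- b) (- a) \<gamma> (bump (- d) (- c)) (- x)"] by simp
  finally show ?thesis .
qed

lemma rl_right_bump_pairing_inner:
  assumes \<gamma>: "\<gamma> < 1" and AB: "a \<le> A" "A < c" "c < d" "d < B" "B \<le> b"
    and q: "continuous_on {a..b} q" "rl_left_continuous a b \<gamma> q"
  shows "integral {A..B} (\<lambda>x. q x * rl_right a b \<gamma> (bump c d) x) =
    integral {c..d} (\<lambda>t. bump c d t * rl_left A b \<gamma> q t)"
proof -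
  have Ab: "A < b" using AB by simp
  note tr = rl_left_truncate[OF \<gamma> AB(1) Ab q]
  have "integral {A..B} (\<lambda>x. q x * rl_right a b \<gamma> (bump c d) x) =
      integral {- d..- c} (\<lambda>t. bump (- d) (- c) t * rl_right (- b) (- A) \<gamma> (\<lambda>t. q (- t)) t)"
    using AB rl_right_bump_pairing_uminus[OF \<gamma>, of a A B b c d q]
    by (simp add: rl_left_bump_pairing_inner[OF \<gamma> _ _ _ _ _ tr(4,5)])
  \<comment> \<open>Reflection back to \<open>{c..d}\<close>, where the right derivative based at
    \<open>- A\<close> of the reflected function becomes the left derivative of \<open>q\<close>
    based at \<open>A\<close>.\<close>
  also have "\<dots> = integral {c..d} (\<lambda>t. bump c d t * rl_right (- b) (- A) \<gamma> (\<lambda>t. q (- t)) (- t))"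
    using Henstock_Kurzweil_Integration.integral_reflect_real
      [of d c "\<lambda>t. bump c d t * rl_right (- b) (- A) \<gamma> (\<lambda>t. q (- t)) (- t)"]
    by (simp add: bump_uminus)
  also have "\<dots> = integral {c..d} (\<lambda>t. bump c d t * rl_left A b \<gamma> q t)"
    using AB by (intro integral_cong) (simp add: tr(2))
  finally show ?thesis .
qed

lemma rl_right_bump_pairing_outer:
  assumes \<gamma>: "\<gamma> < 1" and AB: "a \<le> A" "A < B" "B < c" "c < d" "d < b"
    and q: "continuous_on {a..b} q" "rl_left_continuous a b \<gamma> q"
  shows "integral {A..B} (\<lambda>x. q x * rl_right a b \<gamma> (bump c d) x) =
    integral {c..d} (\<lambda>t. bump c d t * (rl_left A b \<gamma> q t - rl_left B b \<gamma> q t))"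
proof -
  let ?q = "\<lambda>t. q (- t)"
  let ?R = "\<lambda>e. rl_right (- b) (- e) \<gamma> ?q"
  have Ab: "A < b" "a \<le> B" "B < b" using AB by simp_all
  note trA = rl_left_truncate[OF \<gamma> AB(1) Ab(1) q]
  note trB = rl_left_truncate[OF \<gamma> Ab(2,3) q]
  have "integral {A..B} (\<lambda>x. q x * rl_right a b \<gamma> (bump c d) x) =
      integral {- d..- c} (\<lambda>t. bump (- d) (- c) t * (?R A t - ?R B t))"
    using AB rl_right_bump_pairing_uminus[OF \<gamma>, of a A B b c d q]
    by (simp add: rl_left_bump_pairing_outer[OF \<gamma> _ _ _ _ _ trA(4,5)])
  also have "\<dots> = integral {c..d} (\<lambda>t. bump c d t * (?R A (- t) - ?R B (- t)))"
    using Henstock_Kurzweil_Integration.integral_reflect_real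
      [of d c "\<lambda>t. bump c d t * (?R A (- t) - ?R B (- t))"]
    by (simp add: bump_uminus)
  also have "\<dots> = integral {c..d} (\<lambda>t. bump c d t * (rl_left A b \<gamma> q t - rl_left B b \<gamma> q t))"
    using AB by (intro integral_cong) (simp add: trA(2) trB(2))
  finally show ?thesis .
qed

section \<open>The fundamental lemma of the calculus of variations\<close>

text \<open>If \<open>E\<close> were positive at \<open>x\<close>, it would be positive on a small
  interval centred at \<open>x\<close>, and its integral against the bump of that interval could not
  be zero.\<close>

lemma bump_integrals_zero_imp_nonpos:
  fixes E :: "real \<Rightarrow> real"
  assumes E: "continuous_on {lo<..<hi} E"
    and int0: "\<And>c d. lo < c \<Longrightarrow> c < d \<Longrightarrow> d < hi \<Longrightarrow> integral {c..d} (\<lambda>x. bump c d x * E x) = 0"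
    and x: "x \<in> {lo<..<hi}"
  shows "E x \<le> 0"
proof (rule ccontr)
  assume "\<not> E x \<le> 0"
  then have pos: "E x \<in> {0<..}" by simp
  have "open (E -` {0<..} \<inter> {lo<..<hi})"
    using E by (intro continuous_on_open_vimage[THEN iffD1, rule_format]) auto
  moreover have "x \<in> E -` {0<..} \<inter> {lo<..<hi}" using x pos by simp
  \<comment> \<open>The ball is closed so that \<open>E\<close> is positive on all of
    \<open>{c..d}\<close>, end points included.\<close>
  ultimately obtain e where e: "e > 0" "cball x e \<subseteq> E -` {0<..} \<inter> {lo<..<hi}"
    using open_contains_cball by blast
  define c d where "c = x - e" and "d = x + e"
  have cd: "c < d" "x \<in> {c<..<d}" using e by (auto simp: c_def d_def)
  have sub: "{c..d} \<subseteq> E -` {0<..} \<inter> {lo<..<hi}"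
    using e(2) by (simp add: c_def d_def cball_eq_atLeastAtMost)
  then have "lo < c" "d < hi" using cd by force+
  have cont: "continuous_on {c..d} (\<lambda>x. bump c d x * E x)"
    using sub by (intro continuous_intros continuous_on_subset[OF E]) auto
  then have "(\<lambda>x. bump c d x * E x) integrable_on {c..d}" by (rule integrable_continuous_real)
  then have hi: "((\<lambda>x. bump c d x * E x) has_integral 0) {c..d}"
    using int0[OF \<open>lo < c\<close> cd(1) \<open>d < hi\<close>] by (simp add: has_integral_iff)
  have "bump c d x * E x = 0"
  \<comment> \<open>A continuous nonnegative function with integral zero vanishes everywhere on
    \<open>{c..d}\<close>, in particular at the centre \<open>x\<close>.\<close>
  proof (rule has_integral_0_cbox_imp_0[of c d "\<lambda>x. bump c d x * E x"])
    show "0 \<le> bump c d t * E t" if "t \<in> box c d" for t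
      using sub that by (auto simp: bump_def intro!: mult_nonneg_nonneg less_imp_le)
  qed (use cd cont hi in auto)
  then show False using bump_pos[OF cd(2)] pos by simp
qed

lemma bump_integrals_zero_imp_zero:
  fixes E :: "real \<Rightarrow> real"
  assumes E: "continuous_on {lo<..<hi} E"
    and int0: "\<And>c d. lo < c \<Longrightarrow> c < d \<Longrightarrow> d < hi \<Longrightarrow> integral {c..d} (\<lambda>x. bump c d x * E x) = 0"
    and x: "x \<in> {lo<..<hi}"
  shows "E x = 0"
proof -
  have "- E x \<le> 0"
    using E int0 x by (intro bump_integrals_zero_imp_nonpos[of lo hi "\<lambda>x. - E x"] continuous_intros) auto
  then show ?thesis using bump_integrals_zero_imp_nonpos[OF assms] by simp
qed

subsection \<open>First variation of the action\<close>

text \<open>Total differentiability is built up one argument at a time, from a total derivative in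
  the old arguments and a jointly continuous partial derivative in the new one. The set
  \<open>X\<close> allows the first variable to range over a closed interval, with one-sided
  derivatives at its ends.\<close>

lemma has_derivative_extend_real_arg:
  fixes f :: "'a::real_normed_vector \<Rightarrow> real \<Rightarrow> real"
  assumes f1: "((\<lambda>x. f x y) has_derivative f1) (at x within X)"
    and f2: "\<And>x y. x \<in> X \<Longrightarrow> ((\<lambda>s. f x s) has_real_derivative g x y) (at y)"
    and g: "continuous_on (X \<times> UNIV) (\<lambda>(x, y). g x y)" and x: "x \<in> X"
  shows "((\<lambda>(x, y). f x y) has_derivative (\<lambda>(tx, ty). f1 tx + g x y * ty)) (at (x, y) within X \<times> UNIV)"
proof -
  have "((\<lambda>(x, y). f x y) has_derivative (\<lambda>(tx, ty). f1 tx + blinfun_mult_right (g x y) ty))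
      (at (x, y) within X \<times> UNIV)"
  proof (rule has_derivative_partialsI[where f = f and fy = "\<lambda>x y. blinfun_mult_right (g x y)"])
    show "((\<lambda>x. f x y) has_derivative f1) (at x within X)" by (rule f1)
    show "((\<lambda>y. f x y) has_derivative blinfun_apply (blinfun_mult_right (g x y))) (at y within UNIV)"
      if "x \<in> X" for x y
      using f2[OF that] by (simp add: has_field_derivative_def blinfun_mult_right.rep_eq)
    have "continuous_on (X \<times> UNIV) (\<lambda>z. blinfun_mult_right (case z of (x, y) \<Rightarrow> g x y))"
      by (intro bounded_linear.continuous_on[OF bounded_linear_blinfun_mult_right] g)
    then show "continuous (at (x, y) within X \<times> UNIV) (\<lambda>(x, y). blinfun_mult_right (g x y))"
      using x by (auto simp: continuous_on_eq_continuous_within case_prod_unfold)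
  qed auto
  then show ?thesis by (simp add: blinfun_mult_right.rep_eq)
qed

lemma continuous_on_compose_lagrangian:
  assumes "continuous_on ({a..b} \<times> UNIV) (\<lambda>(x, y, u, v). G x y u v)"
    and "continuous_on S X" "continuous_on S Y" "continuous_on S U" "continuous_on S V"
    and "\<And>z. z \<in> S \<Longrightarrow> X z \<in> {a..b :: real}"
  shows "continuous_on S (\<lambda>z. G (X z) (Y z :: real) (U z :: real) (V z :: real) :: real)"
proof -
  have "continuous_on S (\<lambda>z. case (X z, Y z, U z, V z) of (x, y, u, v) \<Rightarrow> G x y u v)"
    by (rule continuous_on_compose2[OF assms(1)]) (use assms in \<open>auto intro!: continuous_intros\<close>)
  then show ?thesis by simp
qed

text \<open>The tuple is nested to the left so that each step appends one real argument to a
  function already known to be differentiable: first \<open>y\<close>, then \<open>u\<close>, then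
  \<open>v\<close>.\<close>

lemma has_derivative_partials4:
  assumes "has_continuous_partials a b F Fx Fy Fu Fv" and x: "x \<in> {a..b}"
  shows "((\<lambda>(((x, y), u), v). F x y u v) has_derivative
      (\<lambda>(((tx, ty), tu), tv). Fx x y u v * tx + Fy x y u v * ty + Fu x y u v * tu + Fv x y u v * tv))
      (at (((x, y), u), v) within (({a..b} \<times> UNIV) \<times> UNIV) \<times> UNIV)"
proof -
  have D: "((\<lambda>s. F s y u v) has_real_derivative Fx x y u v) (at x within {a..b})"
      "((\<lambda>s. F x s u v) has_real_derivative Fy x y u v) (at y)"
      "((\<lambda>s. F x y s v) has_real_derivative Fu x y u v) (at u)"
      "((\<lambda>s. F x y u s) has_real_derivative Fv x y u v) (at v)" if "x \<in> {a..b}" for x y u v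
    using assms(1) that unfolding has_continuous_partials_def by blast+
  have C: "continuous_on ({a..b} \<times> UNIV) (\<lambda>(x, y, u, v). G x y u v)" if "G \<in> {Fx, Fy, Fu, Fv}" for G
    using assms(1) that unfolding has_continuous_partials_def by blast
  have 1: "((\<lambda>(x, y). F x y u v) has_derivative (\<lambda>(tx, ty). Fx x y u v * tx + Fy x y u v * ty))
      (at (x, y) within {a..b} \<times> UNIV)" for u v y
  proof (rule has_derivative_extend_real_arg[where f = "\<lambda>x y. F x y u v" and g = "\<lambda>x y. Fy x y u v"])
    show "((\<lambda>x. F x y u v) has_derivative (\<lambda>tx. Fx x y u v * tx)) (at x within {a..b})"
      using D(1)[OF x] by (simp add: has_field_derivative_def)
    show "continuous_on ({a..b} \<times> UNIV) (\<lambda>(x, y). Fy x y u v)"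
      unfolding case_prod_unfold
      by (intro continuous_on_compose_lagrangian[OF C[of Fy]] continuous_intros) auto
  qed (use D x in auto)
  have 2: "((\<lambda>(z, u). (case z of (x, y) \<Rightarrow> F x y u v)) has_derivative
      (\<lambda>(tz, tu). (case tz of (tx, ty) \<Rightarrow> Fx x y u v * tx + Fy x y u v * ty) +
         (case (x, y) of (x, y) \<Rightarrow> Fu x y u v) * tu))
      (at ((x, y), u) within ({a..b} \<times> UNIV) \<times> UNIV)" for v y u
  proof (rule has_derivative_extend_real_arg[where f = "\<lambda>z u. case z of (x, y) \<Rightarrow> F x y u v"
        and g = "\<lambda>z u. case z of (x, y) \<Rightarrow> Fu x y u v"])
    show "((\<lambda>z. case z of (x, y) \<Rightarrow> F x y u v) has_derivative
        (\<lambda>tz. case tz of (tx, ty) \<Rightarrow> Fx x y u v * tx + Fy x y u v * ty)) (at (x, y) within {a..b} \<times> UNIV)"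
      by (rule 1)
    show "continuous_on (({a..b} \<times> UNIV) \<times> UNIV) (\<lambda>(z, u). case z of (x, y) \<Rightarrow> Fu x y u v)"
      unfolding case_prod_unfold
      by (intro continuous_on_compose_lagrangian[OF C[of Fu]] continuous_intros) auto
  qed (use D x in auto)
  have 3: "((\<lambda>(w, v). (case w of ((x, y), u) \<Rightarrow> F x y u v)) has_derivative
      (\<lambda>(tw, tv). (case tw of (tz, tu) \<Rightarrow> (case tz of (tx, ty) \<Rightarrow> Fx x y u v * tx + Fy x y u v * ty) +
         (case (x, y) of (x, y) \<Rightarrow> Fu x y u v) * tu) +
         (case ((x, y), u) of ((x, y), u) \<Rightarrow> Fv x y u v) * tv))
      (at (((x, y), u), v) within (({a..b} \<times> UNIV) \<times> UNIV) \<times> UNIV)"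
  proof (rule has_derivative_extend_real_arg[where f = "\<lambda>w v. case w of ((x, y), u) \<Rightarrow> F x y u v"
        and g = "\<lambda>w v. case w of ((x, y), u) \<Rightarrow> Fv x y u v"])
    show "((\<lambda>w. case w of ((x, y), u) \<Rightarrow> F x y u v) has_derivative
        (\<lambda>tw. case tw of (tz, tu) \<Rightarrow> (case tz of (tx, ty) \<Rightarrow> Fx x y u v * tx + Fy x y u v * ty) +
         (case (x, y) of (x, y) \<Rightarrow> Fu x y u v) * tu))
        (at ((x, y), u) within ({a..b} \<times> UNIV) \<times> UNIV)"
      using 2[of v y u] by (simp add: case_prod_unfold)
    show "continuous_on ((({a..b} \<times> UNIV) \<times> UNIV) \<times> UNIV)
        (\<lambda>(w, v). case w of ((x, y), u) \<Rightarrow> Fv x y u v)"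
      unfolding case_prod_unfold
      by (intro continuous_on_compose_lagrangian[OF C[of Fv]] continuous_intros) auto
  qed (use D x in auto)
  then show ?thesis by (simp add: case_prod_unfold)
qed

lemma has_derivative_along_line:
  assumes "has_continuous_partials a b F Fx Fy Fu Fv" and x: "x \<in> {a..b}"
  shows "((\<lambda>s. F x (y + s * h) (u + s * k) (v + s * l)) has_real_derivative
      Fy x (y + s * h) (u + s * k) (v + s * l) * h + Fu x (y + s * h) (u + s * k) (v + s * l) * k +
      Fv x (y + s * h) (u + s * k) (v + s * l) * l) (at s)"
proof -
  let ?p = "\<lambda>s. (((x, y + s * h), u + s * k), v + s * l)"
  let ?S = "(({a..b} \<times> UNIV) \<times> UNIV) \<times> UNIV"
  have p: "(?p has_derivative (\<lambda>t. (((0, t * h), t * k), t * l))) (at s within UNIV)"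
    by (auto intro!: derivative_eq_intros)
  \<comment> \<open>The line keeps \<open>x\<close> fixed and so stays in the domain even when
    \<open>x\<close> is an end point of \<open>{a..b}\<close>; the chain rule needs the derivative
    only within the line.\<close>
  have F: "((\<lambda>(((x, y), u), v). F x y u v) has_derivative
      (\<lambda>(((tx, ty), tu), tv). Fx x (y + s * h) (u + s * k) (v + s * l) * tx +
        Fy x (y + s * h) (u + s * k) (v + s * l) * ty + Fu x (y + s * h) (u + s * k) (v + s * l) * tu +
        Fv x (y + s * h) (u + s * k) (v + s * l) * tv)) (at (?p s) within range ?p)"
    by (rule has_derivative_subset[OF has_derivative_partials4[OF assms]]) (use x in auto)
  show ?thesis
    unfolding has_field_derivative_def
    by (rule has_derivative_eq_rhs[OF diff_chain_within[OF p F, unfolded o_def, simplified]])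
      (simp add: fun_eq_iff algebra_simps)
qed

text \<open>The definition provides continuity of the partial derivatives; continuity of the
  function itself comes from total differentiability.\<close>

lemma continuous_on_lagrangian:
  assumes "has_continuous_partials a b F Fx Fy Fu Fv"
  shows "continuous_on ({a..b} \<times> UNIV) (\<lambda>(x, y, u, v). F x y u v)"
proof -
  have "continuous_on ((({a..b} \<times> UNIV) \<times> UNIV) \<times> UNIV) (\<lambda>(((x, y), u), v). F x y u v)"
    unfolding continuous_on_eq_continuous_within
    using has_derivative_continuous[OF has_derivative_partials4[OF assms]] by auto
  from continuous_on_compose2[OF this, of "{a..b} \<times> UNIV"
      "\<lambda>z. (((fst z, fst (snd z)), fst (snd (snd z))), snd (snd (snd z)))"]
  have "continuous_on ({a..b} \<times> UNIV) (\<lambda>z. F (fst z) (fst (snd z)) (fst (snd (snd z))) (snd (snd (snd z))))"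
    by (force intro!: continuous_intros)
  then show ?thesis by (simp add: case_prod_unfold)
qed

text \<open>Differentiation under the integral, justified by joint continuity of the derivative in
  \<open>s\<close> and \<open>x\<close>. \<open>U\<close> and \<open>V\<close> are arbitrary
  continuous functions, so that zero can stand in for an absent fractional derivative.\<close>

lemma has_derivative_action:
  assumes L: "has_continuous_partials a b L Lx Ly Lu Lv" and AB: "a \<le> A" "B \<le> b"
    and c: "continuous_on {A..B} y" "continuous_on {A..B} h" "continuous_on {A..B} U"
      "continuous_on {A..B} k" "continuous_on {A..B} V" "continuous_on {A..B} l"
  shows "((\<lambda>s. integral {A..B} (\<lambda>x. L x (y x + s * h x) (U x + s * k x) (V x + s * l x)))
    has_real_derivative integral {A..B} (\<lambda>x. Ly x (y x) (U x) (V x) * h x +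
      Lu x (y x) (U x) (V x) * k x + Lv x (y x) (U x) (V x) * l x)) (at 0)"
proof -
  define D where "D s x = Ly x (y x + s * h x) (U x + s * k x) (V x + s * l x) * h x +
      Lu x (y x + s * h x) (U x + s * k x) (V x + s * l x) * k x +
      Lv x (y x + s * h x) (U x + s * k x) (V x + s * l x) * l x" for s x
  have snd_cont: "continuous_on (UNIV \<times> {A..B}) (\<lambda>z. f (snd z))" if "continuous_on {A..B} f"
    for f :: "real \<Rightarrow> real"
    by (rule continuous_on_compose2[OF that]) (auto intro!: continuous_intros)
  note c2 = c[THEN snd_cont]
  have comp: "continuous_on (UNIV \<times> {A..B}) (\<lambda>(s, x). G x (y x + s * h x) (U x + s * k x) (V x + s * l x))"
    if "continuous_on ({a..b} \<times> UNIV) (\<lambda>(x, y, u, v). G x y u v)" for G :: lagrangian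
    unfolding case_prod_unfold using AB
    by (intro continuous_on_compose_lagrangian[OF that] continuous_intros c2) auto
  have P: "continuous_on ({a..b} \<times> UNIV) (\<lambda>(x, y, u, v). G x y u v)" if "G \<in> {Ly, Lu, Lv}" for G
    using L that unfolding has_continuous_partials_def by blast
  have "((\<lambda>s. integral (cbox A B) (\<lambda>x. L x (y x + s * h x) (U x + s * k x) (V x + s * l x)))
    has_field_derivative integral (cbox A B) (D 0)) (at 0)"
  proof (rule leibniz_rule_field_derivative[where U = UNIV])
    show "((\<lambda>s. L x (y x + s * h x) (U x + s * k x) (V x + s * l x)) has_real_derivative D s x) (at s)"
      if "x \<in> cbox A B" for s x
      unfolding D_def using that AB by (intro has_derivative_along_line[OF L]) auto
    show "(\<lambda>x. L x (y x + s * h x) (U x + s * k x) (V x + s * l x)) integrable_on cbox A B" for s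
    proof (rule integrable_continuous)
      show "continuous_on (cbox A B) (\<lambda>x. L x (y x + s * h x) (U x + s * k x) (V x + s * l x))"
        using c AB
        by (intro continuous_on_compose_lagrangian[OF continuous_on_lagrangian[OF L]] continuous_intros) auto
    qed
    show "continuous_on (UNIV \<times> cbox A B) (\<lambda>(s, x). D s x)"
      unfolding D_def case_prod_unfold
      using comp[OF P[of Ly]] comp[OF P[of Lu]] comp[OF P[of Lv]] c2
      by (intro continuous_intros) (auto simp: case_prod_unfold)
  qed auto
  then show ?thesis by (simp add: D_def[abs_def])
qed

text \<open>\<open>y\<close> need not possess the fractional derivatives on which \<open>L\<close> does not depend.\<close>
lemma along_cong:
  assumes "\<not> depends_on_u a b L \<Longrightarrow> (\<And>\<eta> u u' v. F x \<eta> u v = F x \<eta> u' v)"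
    and "\<not> depends_on_v a b L \<Longrightarrow> (\<And>\<eta> u v v'. F x \<eta> u v = F x \<eta> u v')"
    and "depends_on_u a b L \<Longrightarrow> rl_left a b \<alpha> y x = u"
    and "depends_on_v a b L \<Longrightarrow> rl_right a b \<beta> y x = v"
  shows "along a b \<alpha> \<beta> F y x = F x (y x) u v"
proof -
  have "along a b \<alpha> \<beta> F y x = F x (y x) u (rl_right a b \<beta> y x)"
    unfolding along_def using assms(1,3) by (cases "depends_on_u a b L") blast+
  also have "\<dots> = F x (y x) u v"
    using assms(2,4) by (cases "depends_on_v a b L") blast+
  finally show ?thesis .
qed

text \<open>Independence of a slot is inherited by the partial derivatives in the other slots, as
  these are derivatives of literally the same functions.\<close>

lemma independent_of_u:
  assumes "\<not> depends_on_u a b L" "x \<in> {a..b}"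
  shows "L x \<eta> u v = L x \<eta> u' v" "partial_y L x \<eta> u v = partial_y L x \<eta> u' v"
    "partial_u L x \<eta> u v = 0" "partial_v L x \<eta> u v = partial_v L x \<eta> u' v"
proof -
  have L: "L x \<eta> u v = L x \<eta> u' v" for \<eta> u u' v
    using assms unfolding depends_on_u_def by blast
  then show "L x \<eta> u v = L x \<eta> u' v" .
  show "partial_y L x \<eta> u v = partial_y L x \<eta> u' v"
    unfolding partial_y_def by (rule arg_cong[where f = "\<lambda>f. deriv f _"], rule ext, rule L)
  show "partial_v L x \<eta> u v = partial_v L x \<eta> u' v"
    unfolding partial_v_def by (rule arg_cong[where f = "\<lambda>f. deriv f _"], rule ext, rule L)
  have "(\<lambda>s. L x \<eta> s v) = (\<lambda>s. L x \<eta> 0 v)" by (rule ext) (rule L)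
  then have "deriv (\<lambda>s. L x \<eta> s v) u = deriv (\<lambda>s. L x \<eta> 0 v) u" by (rule arg_cong)
  then show "partial_u L x \<eta> u v = 0" unfolding partial_u_def by simp
qed

lemma independent_of_v:
  assumes "\<not> depends_on_v a b L" "x \<in> {a..b}"
  shows "L x \<eta> u v = L x \<eta> u v'" "partial_y L x \<eta> u v = partial_y L x \<eta> u v'"
    "partial_u L x \<eta> u v = partial_u L x \<eta> u v'" "partial_v L x \<eta> u v = 0"
proof -
  have L: "L x \<eta> u v = L x \<eta> u v'" for \<eta> u v v'
    using assms unfolding depends_on_v_def by blast
  then show "L x \<eta> u v = L x \<eta> u v'" .
  show "partial_y L x \<eta> u v = partial_y L x \<eta> u v'"
    unfolding partial_y_def by (rule arg_cong[where f = "\<lambda>f. deriv f _"], rule ext, rule L)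
  show "partial_u L x \<eta> u v = partial_u L x \<eta> u v'"
    unfolding partial_u_def by (rule arg_cong[where f = "\<lambda>f. deriv f _"], rule ext, rule L)
  have "(\<lambda>s. L x \<eta> u s) = (\<lambda>s. L x \<eta> u 0)" by (rule ext) (rule L)
  then have "deriv (\<lambda>s. L x \<eta> u s) v = deriv (\<lambda>s. L x \<eta> u 0) v" by (rule arg_cong)
  then show "partial_v L x \<eta> u v = 0" unfolding partial_v_def by simp
qed

section \<open>Vanishing of the first variation\<close>

text \<open>Fermat's principle on the line \<open>y + s * h\<close>: homogeneity of the norm keeps
  the line in the \<open>\<delta>\<close>-ball for small \<open>s\<close>, and \<open>h\<close>
  vanishes at both ends, so every point near \<open>s = 0\<close> is a competitor.\<close>

lemma local_extremizer_deriv_eq_0: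
  assumes norm: "norm_on a b V N" and ext: "local_extremizer a b V N J ya yb y"
    and h: "V h" "h a = 0" "h b = 0" and V: "\<And>s. V (\<lambda>x. y x + s * h x)"
    and D: "((\<lambda>s. J (\<lambda>x. y x + s * h x)) has_real_derivative D) (at 0)"
  shows "D = 0"
proof -
  obtain \<delta> where \<delta>: "\<delta> > 0" and
    J: "(\<forall>y1. V y1 \<and> y1 a = ya \<and> y1 b = yb \<and> N (\<lambda>x. y x - y1 x) < \<delta> \<longrightarrow> J y \<le> J y1) \<or>
        (\<forall>y1. V y1 \<and> y1 a = ya \<and> y1 b = yb \<and> N (\<lambda>x. y x - y1 x) < \<delta> \<longrightarrow> J y \<ge> J y1)"
    and y: "y a = ya" "y b = yb"
    using ext unfolding local_extremizer_def by blast
  have N0: "N h \<ge> 0" and Ns: "N (\<lambda>x. k * h x) = \<bar>k\<bar> * N h" for k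
    using norm h(1) unfolding norm_on_def by blast+
  \<comment> \<open>Adding \<open>1\<close> keeps the denominator positive even if
    \<open>N h = 0\<close>.\<close>
  define e where "e = \<delta> / (N h + 1)"
  have e: "e > 0" using \<delta> N0 by (simp add: e_def)
  define \<phi> where "\<phi> s = J (\<lambda>x. y x + s * h x)" for s
  have \<phi>0: "\<phi> 0 = J y" by (simp add: \<phi>_def)
  have near: "N (\<lambda>x. y x - (y x + s * h x)) < \<delta>" if "\<bar>s\<bar> < e" for s
  proof -
    have "N (\<lambda>x. y x - (y x + s * h x)) = \<bar>s\<bar> * N h" using Ns[of "- s"] by simp
    also have "\<dots> \<le> \<bar>s\<bar> * (N h + 1)" by (intro mult_left_mono) auto
    also have "\<dots> < e * (N h + 1)" using that N0 by (intro mult_strict_right_mono) auto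
    also have "\<dots> = \<delta>" using N0 by (simp add: e_def)
    finally show ?thesis .
  qed
  have cand: "V (\<lambda>x. y x + s * h x) \<and> y a + s * h a = ya \<and> y b + s * h b = yb \<and>
      N (\<lambda>x. y x - (y x + s * h x)) < \<delta>" if "\<bar>s\<bar> < e" for s
    using V h y near[OF that] by simp
  have "(\<forall>s. \<bar>0 - s\<bar> < e \<longrightarrow> \<phi> 0 \<le> \<phi> s) \<or> (\<forall>s. \<bar>0 - s\<bar> < e \<longrightarrow> \<phi> s \<le> \<phi> 0)"
    using J
  proof (elim disjE)
    assume J: "\<forall>y1. V y1 \<and> y1 a = ya \<and> y1 b = yb \<and> N (\<lambda>x. y x - y1 x) < \<delta> \<longrightarrow> J y \<le> J y1"
    have "\<phi> 0 \<le> \<phi> s" if "\<bar>s\<bar> < e" for s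
      unfolding \<phi>0 unfolding \<phi>_def by (rule J[rule_format]) (rule cand[OF that])
    then show ?thesis by simp
  next
    assume J: "\<forall>y1. V y1 \<and> y1 a = ya \<and> y1 b = yb \<and> N (\<lambda>x. y x - y1 x) < \<delta> \<longrightarrow> J y \<ge> J y1"
    have "\<phi> s \<le> \<phi> 0" if "\<bar>s\<bar> < e" for s
      unfolding \<phi>0 unfolding \<phi>_def by (rule J[rule_format]) (rule cand[OF that])
    then show ?thesis by simp
  qed
  then show ?thesis
    using D[folded \<phi>_def] DERIV_local_min[of \<phi> D 0 e] DERIV_local_max[of \<phi> D 0 e] e by blast
qed

lemma partials_eq:
  assumes "has_continuous_partials a b L Lx Ly Lu Lv" "x \<in> {a..b}"
  shows "partial_y L x \<eta> u v = Ly x \<eta> u v" "partial_u L x \<eta> u v = Lu x \<eta> u v"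
    "partial_v L x \<eta> u v = Lv x \<eta> u v"
  using assms unfolding has_continuous_partials_def partial_y_def partial_u_def partial_v_def
  by (blast intro: DERIV_imp_deriv)+

text \<open>The first variation in the direction of \<open>bump c d\<close>; all three equations
  come from different positions of \<open>{c..d}\<close> in \<open>{a..b}\<close>. Continuity of the
  coefficients is recorded for the integrations by parts that follow.\<close>

lemma weak_euler_lagrange:
  assumes AB: "a \<le> A" "A < B" "B \<le> b" and \<alpha>: "\<alpha> < 1" and \<beta>: "\<beta> < 1"
    and C2: "C2_lagrangian a b L"
    and norm: "norm_on a b (admissible a b \<alpha> \<beta> L) N"
    and ext: "local_extremizer a b (admissible a b \<alpha> \<beta> L) N (action a b A B \<alpha> \<beta> L) ya yb y"
  shows "continuous_on {a..b} (along a b \<alpha> \<beta> (partial_y L) y)"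
    and "continuous_on {a..b} (along a b \<alpha> \<beta> (partial_u L) y)"
    and "continuous_on {a..b} (along a b \<alpha> \<beta> (partial_v L) y)"
    and "\<lbrakk>a \<le> c; c < d; d \<le> b\<rbrakk> \<Longrightarrow>
      integral {A..B} (\<lambda>x. along a b \<alpha> \<beta> (partial_y L) y x * bump c d x) +
      integral {A..B} (\<lambda>x. along a b \<alpha> \<beta> (partial_u L) y x * rl_left a b \<alpha> (bump c d) x) +
      integral {A..B} (\<lambda>x. along a b \<alpha> \<beta> (partial_v L) y x * rl_right a b \<beta> (bump c d) x) = 0"
proof -
  obtain Lx Ly Lu Lv where L: "has_continuous_partials a b L Lx Ly Lu Lv"
    using C2 unfolding C2_lagrangian_def by blast
  have P: "continuous_on ({a..b} \<times> UNIV) (\<lambda>(x, y, u, v). G x y u v)" if "G \<in> {Ly, Lu, Lv}" for G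
    using L that unfolding has_continuous_partials_def by blast
  have ab: "a < b" using AB by simp
  have adm: "admissible a b \<alpha> \<beta> L y" using ext by (simp add: local_extremizer_def)
  have y: "continuous_on {a..b} y" using adm by (simp add: admissible_def)
  \<comment> \<open>Zero replaces a fractional derivative that need not exist, so \<open>U\<close>
    and \<open>V\<close> are continuous in every case.\<close>
  define U where "U = (if depends_on_u a b L then rl_left a b \<alpha> y else (\<lambda>_. 0))"
  define V where "V = (if depends_on_v a b L then rl_right a b \<beta> y else (\<lambda>_. 0))"
  have U: "continuous_on {a..b} U" and V: "continuous_on {a..b} V"
    using adm by (auto simp: U_def V_def admissible_def rl_left_continuous_def rl_right_continuous_def)
  have along_eq:
    "along a b \<alpha> \<beta> (partial_y L) y x = Ly x (y x) (U x) (V x)"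
    "along a b \<alpha> \<beta> (partial_u L) y x = Lu x (y x) (U x) (V x)"
    "along a b \<alpha> \<beta> (partial_v L) y x = Lv x (y x) (U x) (V x)" if x: "x \<in> {a..b}" for x
  proof -
    note [simp] = independent_of_u(3)[OF _ x] independent_of_v(4)[OF _ x]
    note iu = independent_of_u(2,4)[OF _ x] and iv = independent_of_v(2,3)[OF _ x]
    have "along a b \<alpha> \<beta> (partial_y L) y x = partial_y L x (y x) (U x) (V x)"
      by (rule along_cong[where L = L]) (auto simp: U_def V_def intro: iu iv)
    then show "along a b \<alpha> \<beta> (partial_y L) y x = Ly x (y x) (U x) (V x)"
      by (simp add: partials_eq[OF L x])
    have "along a b \<alpha> \<beta> (partial_u L) y x = partial_u L x (y x) (U x) (V x)"
      by (rule along_cong[where L = L]) (auto simp: U_def V_def intro: iu iv)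
    then show "along a b \<alpha> \<beta> (partial_u L) y x = Lu x (y x) (U x) (V x)"
      by (simp add: partials_eq[OF L x])
    have "along a b \<alpha> \<beta> (partial_v L) y x = partial_v L x (y x) (U x) (V x)"
      by (rule along_cong[where L = L]) (auto simp: U_def V_def intro: iu iv)
    then show "along a b \<alpha> \<beta> (partial_v L) y x = Lv x (y x) (U x) (V x)"
      by (simp add: partials_eq[OF L x])
  qed
  have comp: "continuous_on {a..b} (\<lambda>x. G x (y x) (U x) (V x))" if "G \<in> {Ly, Lu, Lv}" for G
    by (intro continuous_on_compose_lagrangian[OF P[OF that]] continuous_intros y U V)
  show cy: "continuous_on {a..b} (along a b \<alpha> \<beta> (partial_y L) y)"
    using comp[of Ly] by (simp only: continuous_on_cong[OF refl along_eq(1)] insert_iff simp_thms)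
  show cu: "continuous_on {a..b} (along a b \<alpha> \<beta> (partial_u L) y)"
    using comp[of Lu] by (simp only: continuous_on_cong[OF refl along_eq(2)] insert_iff simp_thms)
  show cv: "continuous_on {a..b} (along a b \<alpha> \<beta> (partial_v L) y)"
    using comp[of Lv] by (simp only: continuous_on_cong[OF refl along_eq(3)] insert_iff simp_thms)
  assume cd: "a \<le> c" "c < d" "d \<le> b"
  define h where "h = bump c d"
  define k where "k = rl_left a b \<alpha> h"
  define l where "l = rl_right a b \<beta> h"
  have h: "continuous_on {a..b} h" unfolding h_def by (intro continuous_intros)
  have hl: "rl_left_continuous a b \<alpha> h" and hr: "rl_right_continuous a b \<beta> h"
    unfolding h_def using cd ab \<alpha> \<beta> rl_left_bump(1) rl_right_bump_continuous by auto
  then have k: "continuous_on {a..b} k" and l: "continuous_on {a..b} l"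
    by (simp_all add: k_def l_def rl_left_continuous_def rl_right_continuous_def)
  have h0: "h a = 0" "h b = 0" using cd by (auto simp: h_def bump_eq_0)
  have h_adm: "admissible a b \<alpha> \<beta> L h" using h hl hr by (simp add: admissible_def)
  \<comment> \<open>The test function has both fractional derivatives, so the perturbation inherits
    from \<open>y\<close> whichever of them \<open>L\<close> requires.\<close>
  have ys_adm: "admissible a b \<alpha> \<beta> L (\<lambda>x. y x + s * h x)" for s
    using adm h hl hr rl_left_add_cmult(1)[OF \<alpha> ab y h] rl_right_add_cmult(1)[OF \<beta> ab y h]
    by (auto simp: admissible_def intro!: continuous_intros)
  have act: "action a b A B \<alpha> \<beta> L (\<lambda>x. y x + s * h x) =
      integral {A..B} (\<lambda>x. L x (y x + s * h x) (U x + s * k x) (V x + s * l x))" for s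
    unfolding action_def
  proof (rule integral_cong)
    fix x assume "x \<in> {A..B}"
    then have x: "x \<in> {a..b}" using AB by auto
    show "along a b \<alpha> \<beta> L (\<lambda>x. y x + s * h x) x = L x (y x + s * h x) (U x + s * k x) (V x + s * l x)"
    proof (rule along_cong[where L = L])
      show "rl_left a b \<alpha> (\<lambda>x. y x + s * h x) x = U x + s * k x" if "depends_on_u a b L"
        using that adm rl_left_add_cmult(2)[OF \<alpha> ab y h _ hl x, of s]
        by (simp add: admissible_def U_def k_def)
      show "rl_right a b \<beta> (\<lambda>x. y x + s * h x) x = V x + s * l x" if "depends_on_v a b L"
        using that adm rl_right_add_cmult(2)[OF \<beta> ab y h _ hr x, of s]
        by (simp add: admissible_def V_def l_def)
    qed (use independent_of_u(1)[OF _ x] independent_of_v(1)[OF _ x] in blast)+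
  qed
  have sub: "continuous_on {A..B} f" if "continuous_on {a..b} f" for f :: "real \<Rightarrow> real"
    using AB by (intro continuous_on_subset[OF that]) auto
  have "((\<lambda>s. action a b A B \<alpha> \<beta> L (\<lambda>x. y x + s * h x)) has_real_derivative
      integral {A..B} (\<lambda>x. Ly x (y x) (U x) (V x) * h x +
      Lu x (y x) (U x) (V x) * k x + Lv x (y x) (U x) (V x) * l x)) (at 0)"
    unfolding act by (rule has_derivative_action[OF L AB(1,3) sub[OF y] sub[OF h] sub[OF U] sub[OF k] sub[OF V] sub[OF l]])
  from local_extremizer_deriv_eq_0[OF norm ext h_adm h0 ys_adm this]
  have "integral {A..B} (\<lambda>x. Ly x (y x) (U x) (V x) * h x +
      Lu x (y x) (U x) (V x) * k x + Lv x (y x) (U x) (V x) * l x) = 0" .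
  also have "integral {A..B} (\<lambda>x. Ly x (y x) (U x) (V x) * h x +
      Lu x (y x) (U x) (V x) * k x + Lv x (y x) (U x) (V x) * l x) =
      integral {A..B} (\<lambda>x. along a b \<alpha> \<beta> (partial_y L) y x * h x +
        along a b \<alpha> \<beta> (partial_u L) y x * k x + along a b \<alpha> \<beta> (partial_v L) y x * l x)"
    using AB by (intro integral_cong) (simp add: along_eq)
  also have "\<dots> = integral {A..B} (\<lambda>x. along a b \<alpha> \<beta> (partial_y L) y x * h x) +
      integral {A..B} (\<lambda>x. along a b \<alpha> \<beta> (partial_u L) y x * k x) +
      integral {A..B} (\<lambda>x. along a b \<alpha> \<beta> (partial_v L) y x * l x)"
    by (simp add: integral_add integrable_add integrable_continuous_real continuous_on_add continuous_on_mult sub cy cu cv h k l)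
  finally show "integral {A..B} (\<lambda>x. along a b \<alpha> \<beta> (partial_y L) y x * bump c d x) +
      integral {A..B} (\<lambda>x. along a b \<alpha> \<beta> (partial_u L) y x * rl_left a b \<alpha> (bump c d) x) +
      integral {A..B} (\<lambda>x. along a b \<alpha> \<beta> (partial_v L) y x * rl_right a b \<beta> (bump c d) x) = 0"
    by (simp add: h_def k_def l_def)
qed

section \<open>The equations on the three intervals\<close>

lemma vanishes_on_intervalI:
  assumes "lo < hi" "\<And>x. x \<in> {lo<..<hi} \<Longrightarrow> E x = 0"
  shows "vanishes_on_interval lo hi E"
  unfolding vanishes_on_interval_def
proof (intro conjI ballI)
  show "(E \<longlongrightarrow> 0) (at_right lo)"
    by (rule tendsto_eventually)
      (use eventually_at_right_real[OF assms(1)] in eventually_elim, simp add: assms(2))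
  show "(E \<longlongrightarrow> 0) (at_left hi)"
    by (rule tendsto_eventually)
      (use eventually_at_left_real[OF assms(1)] in eventually_elim, simp add: assms(2))
qed (rule assms)

theorem theorem8:
  fixes a b A B \<alpha> \<beta> ya yb :: real
    and L :: "real \<Rightarrow> real \<Rightarrow> real \<Rightarrow> real \<Rightarrow> real"
    and N :: "(real \<Rightarrow> real) \<Rightarrow> real"
    and y :: "real \<Rightarrow> real"
  assumes "a \<le> A" "A < B" "B \<le> b"
    and "0 < \<alpha>" "\<alpha> < 1" "0 < \<beta>" "\<beta> < 1"
    and "C2_lagrangian a b L"
    and "depends_on_u a b L \<longrightarrow> ya = 0"
    and "depends_on_v a b L \<longrightarrow> yb = 0"
    and "norm_on a b (admissible a b \<alpha> \<beta> L) N"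
    and "local_extremizer a b (admissible a b \<alpha> \<beta> L) N (action a b A B \<alpha> \<beta> L) ya yb y"
    and "rl_right_continuous a b \<alpha> (along a b \<alpha> \<beta> (partial_u L) y)"
    and "rl_left_continuous a b \<beta> (along a b \<alpha> \<beta> (partial_v L) y)"
  shows
    "(let Ly = along a b \<alpha> \<beta> (partial_y L) y;
          Lu = along a b \<alpha> \<beta> (partial_u L) y;
          Lv = along a b \<alpha> \<beta> (partial_v L) y
      in
        ((\<forall>x\<in>{A<..<B}. rl_right_exists a B \<alpha> Lu x \<and> rl_left_exists A b \<beta> Lv x) \<and>
         vanishes_on_interval A B (\<lambda>x. Ly x + rl_right a B \<alpha> Lu x + rl_left A b \<beta> Lv x)) \<and>
        (a < A \<longrightarrow>
         (\<forall>x\<in>{a<..<A}. rl_right_exists a B \<alpha> Lu x \<and> rl_right_exists a A \<alpha> Lu x) \<and>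
         vanishes_on_interval a A (\<lambda>x. rl_right a B \<alpha> Lu x - rl_right a A \<alpha> Lu x)) \<and>
        (B < b \<longrightarrow>
         (\<forall>x\<in>{B<..<b}. rl_left_exists A b \<beta> Lv x \<and> rl_left_exists B b \<beta> Lv x) \<and>
         vanishes_on_interval B b (\<lambda>x. rl_left A b \<beta> Lv x - rl_left B b \<beta> Lv x)))"
proof -
  define Ly where "Ly = along a b \<alpha> \<beta> (partial_y L) y"
  define Lu where "Lu = along a b \<alpha> \<beta> (partial_u L) y"
  define Lv where "Lv = along a b \<alpha> \<beta> (partial_v L) y"
  note AB = assms(1-3) and \<alpha> = assms(5) and \<beta> = assms(7)
  have ab: "a < b" "a < B" "A < b" "A \<le> b" "a \<le> B" using AB by simp_all
  note weak = weak_euler_lagrange[OF AB \<alpha> \<beta> assms(8,11,12), folded Ly_def Lu_def Lv_def]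
  note cu = weak(2) assms(13)[folded Lu_def] and cv = weak(3) assms(14)[folded Lv_def]
  note RB = rl_right_truncate[OF \<alpha> ab(2) AB(3) cu]
  \<comment> \<open>Truncation at \<open>A\<close> presupposes \<open>a < A\<close>, and truncation
    at \<open>B\<close> presupposes \<open>B < b\<close>; these premises stay open here and in
    \<open>LB\<close>.\<close>
  note RA = rl_right_truncate[OF \<alpha> _ ab(4) cu]
  note LA = rl_left_truncate[OF \<beta> AB(1) ab(3) cv]
  note LB = rl_left_truncate[OF \<beta> ab(5) _ cv]
  have zero: "integral {A..B} f = 0" if "\<And>x. x \<in> {A..B} \<Longrightarrow> f x = 0" for f :: "real \<Rightarrow> real"
    using that integral_cong[of "{A..B}" f "\<lambda>_. 0"] by simp
  have inner: "vanishes_on_interval A B (\<lambda>x. Ly x + rl_right a B \<alpha> Lu x + rl_left A b \<beta> Lv x)"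
  proof (rule vanishes_on_intervalI[OF AB(2)], rule bump_integrals_zero_imp_zero[where lo = A and hi = B
      and E = "\<lambda>x. Ly x + rl_right a B \<alpha> Lu x + rl_left A b \<beta> Lv x"])
    have cLy: "continuous_on {A<..<B} Ly"
      using AB by (intro continuous_on_subset[OF weak(1)]) auto
    have cRB: "continuous_on {A<..<B} (rl_right a B \<alpha> Lu)"
      using AB by (intro continuous_on_subset[OF RB(3)]) auto
    have cLA: "continuous_on {A<..<B} (rl_left A b \<beta> Lv)"
      using AB by (intro continuous_on_subset[OF LA(3)]) auto
    show "continuous_on {A<..<B} (\<lambda>x. Ly x + rl_right a B \<alpha> Lu x + rl_left A b \<beta> Lv x)"
      by (intro continuous_intros cLy cRB cLA)
    \<comment> \<open>A test interval inside \<open>{A..B}\<close> meets all three terms; the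
      pairings turn each of them into an integral over \<open>{c..d}\<close> against the same
      bump.\<close>
    fix c d assume cd: "A < c" "c < d" "d < B"
    have "integral {A..B} (\<lambda>x. Ly x * bump c d x) = integral {c..d} (\<lambda>x. Ly x * bump c d x)"
    proof (rule integral_spike_set)
      have "bump c d x = 0" if "x \<notin> {c..d}" for x
        using that cd by (intro bump_eq_0) auto
      then have "{x \<in> {A..B} - {c..d}. Ly x * bump c d x \<noteq> 0} = {}"
        "{x \<in> {c..d} - {A..B}. Ly x * bump c d x \<noteq> 0} = {}" using cd by auto
      then show "negligible {x \<in> {A..B} - {c..d}. Ly x * bump c d x \<noteq> 0}"
        "negligible {x \<in> {c..d} - {A..B}. Ly x * bump c d x \<noteq> 0}" by (simp_all only: negligible_empty)
    qed
    then have "integral {c..d} (\<lambda>x. Ly x * bump c d x) +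
        integral {c..d} (\<lambda>x. bump c d x * rl_right a B \<alpha> Lu x) +
        integral {c..d} (\<lambda>x. bump c d x * rl_left A b \<beta> Lv x) = 0"
      using weak(4)[of c d] cd AB
        rl_left_bump_pairing_inner[OF \<alpha> AB(1) cd AB(3) cu]
        rl_right_bump_pairing_inner[OF \<beta> AB(1) cd AB(3) cv] by simp
    moreover have "integral {c..d} (\<lambda>x. Ly x * bump c d x + bump c d x * rl_right a B \<alpha> Lu x +
          bump c d x * rl_left A b \<beta> Lv x) =
        integral {c..d} (\<lambda>x. Ly x * bump c d x) +
        integral {c..d} (\<lambda>x. bump c d x * rl_right a B \<alpha> Lu x) +
        integral {c..d} (\<lambda>x. bump c d x * rl_left A b \<beta> Lv x)"
    proof -
      have sub: "{c..d} \<subseteq> {A<..<B}" using cd by auto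
      note cs = continuous_on_subset[OF cLy sub] continuous_on_subset[OF cRB sub] continuous_on_subset[OF cLA sub]
      show ?thesis
        by (simp add: integral_add integrable_add integrable_continuous_real continuous_on_mult cs continuous_on_bump)
    qed
    ultimately show "integral {c..d} (\<lambda>x. bump c d x * (Ly x + rl_right a B \<alpha> Lu x + rl_left A b \<beta> Lv x)) = 0"
      by (simp add: algebra_simps)
  qed
  have left: "vanishes_on_interval a A (\<lambda>x. rl_right a B \<alpha> Lu x - rl_right a A \<alpha> Lu x)" if aA: "a < A"
  proof (rule vanishes_on_intervalI[OF aA], rule bump_integrals_zero_imp_zero[where lo = a and hi = A
      and E = "\<lambda>x. rl_right a B \<alpha> Lu x - rl_right a A \<alpha> Lu x"])
    show "continuous_on {a<..<A} (\<lambda>x. rl_right a B \<alpha> Lu x - rl_right a A \<alpha> Lu x)"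
      by (intro continuous_intros RA[OF aA] continuous_on_subset[OF RB(3)]) (use AB in auto)
    \<comment> \<open>For a test interval to the left of \<open>A\<close>, the test function is zero
      on \<open>{A..B}\<close>, and so is its right derivative, which looks only to the right. Only
      the \<open>u\<close>-term survives.\<close>
    fix c d assume cd: "a < c" "c < d" "d < A"
    have "integral {A..B} (\<lambda>x. Ly x * bump c d x) = 0"
      using cd by (intro zero) (simp add: bump_eq_0)
    moreover have "integral {A..B} (\<lambda>x. Lv x * rl_right a b \<beta> (bump c d) x) = 0"
      using cd AB \<beta> by (intro zero) (simp add: rl_right_bump_eq_0)
    ultimately show "integral {c..d} (\<lambda>x. bump c d x * (rl_right a B \<alpha> Lu x - rl_right a A \<alpha> Lu x)) = 0"
      using weak(4)[of c d] cd AB rl_left_bump_pairing_outer[OF \<alpha> cd AB(2,3) cu] by simp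
  qed
  have right: "vanishes_on_interval B b (\<lambda>x. rl_left A b \<beta> Lv x - rl_left B b \<beta> Lv x)" if Bb: "B < b"
  proof (rule vanishes_on_intervalI[OF Bb], rule bump_integrals_zero_imp_zero[where lo = B and hi = b
      and E = "\<lambda>x. rl_left A b \<beta> Lv x - rl_left B b \<beta> Lv x"])
    show "continuous_on {B<..<b} (\<lambda>x. rl_left A b \<beta> Lv x - rl_left B b \<beta> Lv x)"
      by (intro continuous_intros LB[OF Bb] continuous_on_subset[OF LA(3)]) (use AB in auto)
    \<comment> \<open>To the right of \<open>B\<close> the roles are exchanged: the test function
      and its left derivative vanish on \<open>{A..B}\<close>, which leaves the
      \<open>v\<close>-term.\<close>
    fix c d assume cd: "B < c" "c < d" "d < b"
    have "integral {A..B} (\<lambda>x. Ly x * bump c d x) = 0"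
      using cd by (intro zero) (simp add: bump_eq_0)
    moreover have "integral {A..B} (\<lambda>x. Lu x * rl_left a b \<alpha> (bump c d) x) = 0"
      using cd AB \<alpha> by (intro zero) (simp add: rl_left_bump_eq_0)
    ultimately show "integral {c..d} (\<lambda>x. bump c d x * (rl_left A b \<beta> Lv x - rl_left B b \<beta> Lv x)) = 0"
      using weak(4)[of c d] cd AB rl_right_bump_pairing_outer[OF \<beta> AB(1,2) cd cv] by simp
  qed
  show ?thesis
    unfolding Let_def Ly_def[symmetric] Lu_def[symmetric] Lv_def[symmetric]
    using inner left right RB(2) RA(2) LA(1) LB(1) AB by auto
qed

end
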